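(* Let $\frac12\le s<1$ and $\Lambda\in\mathbb{N}$, $\Lambda\ge1$. There exists $\bar\varepsilon>0$ such that for every $0<\varepsilon<\bar\varepsilon$ the set of global minimizers of $\mathcal{E}^s_\varepsilon$ (in $\mathcal{X}^\Lambda$) is $\mathcal{C}^\Lambda$.
   Context: Let $\mathcal{X}^\Lambda:=[0,\Lambda)^\Lambda$; entries of $X=(x_1,\dots,x_\Lambda)\in\mathcal{X}^\Lambda$ need not be distinct. Let $\mathcal{S}(X):=\{x_1,\dots,x_\Lambda\}$, let $\mathcal{R}^\Lambda$ be the set of $X\in\mathcal{X}^\Lambda$ with pairwise distinct entries, and let $\mathcal{C}^\Lambda:=\{X\in\mathcal{R}^\Lambda:\ \mathcal{S}(X)=\{\tau,1+\tau,\dots,\Lambda-1+\tau\}\text{ for some }\tau\in[0,1)\}$. Let $\mu^X:=\sum_{\lambda=1}^{\Lambda}\sum_{k\in\mathbb{Z}}\delta_{x_\lambda+\Lambda k}$, and let $u^X\in BV_{\rm loc}(\mathbb{R})$ be the function, unique up to additive constants and $\Lambda$-periodic, whose distributional derivative is $(u^X)'=\mathrm{d}x-\mu^X$. Let $\rho$ be a fixed standard mollifier supported in $(-1,1)$ (smooth, nonnegative, even, with integral $1$), $\rho_\varepsilon(x):=\frac1\varepsilon\rho(\frac x\varepsilon)$, and $u^X_\varepsilon:=\rho_\varepsilon*u^X$. For $\frac12\le s<1$ and $\varepsilon>0$, $$\mathcal{E}^s_\varepsilon(X):=\frac12\int_0^\Lambda \mathrm{d}x\int_{\mathbb{R}}\frac{|u^X_\varepsilon(x)-u^X_\varepsilon(y)|^2}{|x-y|^{1+2s}}\,\mathrm{d}y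 .$$ *)

theory Defs
  imports "HOL-Analysis.Analysis"
begin

definition smooth :: "(real \<Rightarrow> real) \<Rightarrow> bool" where
  "smooth f \<longleftrightarrow> (\<forall>n x. (deriv ^^ n) f differentiable (at x))"

definition test_function :: "(real \<Rightarrow> real) \<Rightarrow> bool" where
  "test_function \<phi> \<longleftrightarrow> smooth \<phi> \<and> compact (closure {x. \<phi> x \<noteq> 0})"

text \<open>Elements of \<open>L\<^sup>1\<^sub>l\<^sub>o\<^sub>c\<close> are classes modulo null sets; they are
  represented here by Borel functions.\<close>

definition locally_integrable :: "(real \<Rightarrow> real) \<Rightarrow> bool" where
  "locally_integrable u \<longleftrightarrow> (\<forall>a b. set_integrable lborel {a..b} u)"

definition BV_loc :: "(real \<Rightarrow> real) set" where
  "BV_loc = {u. locally_integrable u \<and>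
     (\<forall>a b. bdd_above {\<integral>x. u x * deriv \<phi> x \<partial>lborel | \<phi>.
        test_function \<phi> \<and> closure {x. \<phi> x \<noteq> 0} \<subseteq> {a<..<b} \<and> (\<forall>x. \<bar>\<phi> x\<bar> \<le> 1)})}"

text \<open>A distribution is given by its action on test functions.\<close>

definition has_distributional_derivative ::
    "(real \<Rightarrow> real) \<Rightarrow> ((real \<Rightarrow> real) \<Rightarrow> real) \<Rightarrow> bool" where
  "has_distributional_derivative u T \<longleftrightarrow>
     (\<forall>\<phi>. test_function \<phi> \<longrightarrow> (\<integral>x. u x * deriv \<phi> x \<partial>lborel) = - T \<phi>)"

definition configs :: "nat \<Rightarrow> (nat \<Rightarrow> real) set" where
  "configs \<Lambda> = (\<Pi>\<^sub>E i\<in>{1..\<Lambda>}. {0..<real \<Lambda>})"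

definition distinct_configs :: "nat \<Rightarrow> (nat \<Rightarrow> real) set" where
  "distinct_configs \<Lambda> = {X \<in> configs \<Lambda>. inj_on X {1..\<Lambda>}}"

definition equispaced_configs :: "nat \<Rightarrow> (nat \<Rightarrow> real) set" where
  "equispaced_configs \<Lambda> = {X \<in> distinct_configs \<Lambda>.
     \<exists>\<tau>. 0 \<le> \<tau> \<and> \<tau> < 1 \<and> X ` {1..\<Lambda>} = {real j + \<tau> | j. j < \<Lambda>}}"

text \<open>The measure \<open>\<mu>\<^sup>X\<close>, the sum over \<open>i\<close> and \<open>k\<close> of the Dirac masses at
  \<open>X i + \<Lambda> k\<close>: the push-forward of the counting measure counts points with
  multiplicity.\<close>

definition point_measure :: "nat \<Rightarrow> (nat \<Rightarrow> real) \<Rightarrow> real measure" where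
  "point_measure \<Lambda> X = distr (count_space ({1..\<Lambda>} \<times> (UNIV :: int set))) borel
     (\<lambda>(i, k). X i + real \<Lambda> * of_int k)"

text \<open>The defining condition determines \<open>u\<^sup>X\<close> up to an additive constant and up
  to null sets. Neither affects the energy below.\<close>

definition potential :: "nat \<Rightarrow> (nat \<Rightarrow> real) \<Rightarrow> real \<Rightarrow> real" where
  "potential \<Lambda> X = (SOME u. u \<in> BV_loc \<and>
     has_distributional_derivative u
       (\<lambda>\<phi>. (\<integral>x. \<phi> x \<partial>lborel) - (\<integral>x. \<phi> x \<partial>point_measure \<Lambda> X)))"

text \<open>The support condition only asks that \<open>\<rho>\<close> vanish outside \<open>(-1,1)\<close>, so that
  the usual bump function \<open>c * exp (- 1 / (1 - x\<^sup>2))\<close> is allowed.\<close>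

definition mollifier :: "(real \<Rightarrow> real) \<Rightarrow> bool" where
  "mollifier \<rho> \<longleftrightarrow> smooth \<rho> \<and> (\<forall>x. 0 \<le> \<rho> x) \<and> (\<forall>x. \<rho> (- x) = \<rho> x) \<and>
     {x. \<rho> x \<noteq> 0} \<subseteq> {-1<..<1} \<and> (\<integral>x. \<rho> x \<partial>lborel) = 1"

definition rescale :: "(real \<Rightarrow> real) \<Rightarrow> real \<Rightarrow> real \<Rightarrow> real" where
  "rescale \<rho> \<epsilon> x = 1 / \<epsilon> * \<rho> (x / \<epsilon>)"

definition convolve :: "(real \<Rightarrow> real) \<Rightarrow> (real \<Rightarrow> real) \<Rightarrow> real \<Rightarrow> real" where
  "convolve f g x = (\<integral>y. f (x - y) * g y \<partial>lborel)"

definition mollified_potential ::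
    "(real \<Rightarrow> real) \<Rightarrow> real \<Rightarrow> nat \<Rightarrow> (nat \<Rightarrow> real) \<Rightarrow> real \<Rightarrow> real" where
  "mollified_potential \<rho> \<epsilon> \<Lambda> X = convolve (rescale \<rho> \<epsilon>) (potential \<Lambda> X)"

text \<open>Valued in \<open>[0,\<infinity>]\<close>, so that no integrability is presupposed. On the null
  set \<open>x = y\<close> the quotient is \<open>0\<close>.\<close>

definition energy ::
    "(real \<Rightarrow> real) \<Rightarrow> real \<Rightarrow> real \<Rightarrow> nat \<Rightarrow> (nat \<Rightarrow> real) \<Rightarrow> ennreal" where
  "energy \<rho> s \<epsilon> \<Lambda> X = 1 / 2 *
     (\<integral>\<^sup>+x\<in>{0..real \<Lambda>}. (\<integral>\<^sup>+y.
        ennreal (\<bar>mollified_potential \<rho> \<epsilon> \<Lambda> X x - mollified_potential \<rho> \<epsilon> \<Lambda> X y\<bar>\<^sup>2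
                 / \<bar>x - y\<bar> powr (1 + 2 * s)) \<partial>lborel) \<partial>lborel)"

definition global_minimizers :: "'a set \<Rightarrow> ('a \<Rightarrow> 'b::linorder) \<Rightarrow> 'a set" where
  "global_minimizers A F = {x \<in> A. \<forall>y\<in>A. F x \<le> F y}"

end

theory Submission imports Defs begin

text \<open>Write \<open>L\<close> for the period. The potential \<open>u\<close> is a sum of translates of the
  sawtooth \<open>frac (x / L)\<close>, so after the substitution \<open>y = x + h\<close> the energy is the integral over
  \<open>h\<close>, with weight \<open>\<bar>h\<bar>\<close> to the power \<open>- 1 - 2 s\<close>, of a sum of pair interactions
  \<open>A h (x\<^sub>i - x\<^sub>j + z)\<close> averaged over \<open>z\<close>, the difference of two independent variables with density
  \<open>\<rho>\<^sub>\<epsilon>\<close>. For \<open>0 \<le> h \<le> L\<close> and \<open>0 \<le> t \<le> L\<close> one has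
  \<open>A h t = max 0 (h - t) + max 0 (h - (L - t)) - h\<^sup>2 / L\<close>, which is convex in \<open>t\<close>.
  Hence, if all gaps of the configuration are at least \<open>2 \<epsilon>\<close>, Jensen's inequality applied to the
  differences of \<open>k\<close>-th cyclic neighbours (whose mean is \<open>k\<close>) gives the inequality with the
  equispaced configurations for every \<open>h\<close> and \<open>z\<close> separately; it is strict for \<open>h\<close>
  between a gap smaller than 1 and 1. If some gap is smaller than \<open>2 \<epsilon>\<close>, this gap costs a fixed
  amount on \<open>1/4 \<le> h < 1/2\<close>, nothing is lost for \<open>\<bar>h\<bar> < 1/2\<close>, and the loss for other \<open>h\<close>
  is \<open>O(\<epsilon>)\<close> because \<open>A h\<close> is Lipschitz.\<close>

section \<open>Smooth functions and mollification\<close>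

text \<open>The weight is not integrable at \<open>h = 0\<close>, so near the origin no error of
  order \<epsilon> can be afforded; this forces two regimes. For |h| and |z| up to 1/2 the points k
  + z with 0 < k < L keep distance at least 1/2 from 0 and L, both max terms vanish, and the
  equispaced pairs sit at the absolute minimum of the interaction: the comparison is exact whatever
  the gaps are. For larger |h| the weight is integrable and an O(\<epsilon>) loss can be paid. The
  separation 2 \<epsilon> is the bound on |z|. For 0 < h < L the periodic function
  \<open>A h\<close> is convex on [0, L] but has a concave kink at the multiples of L, so Jensen
  needs all shifted differences to stay in [0, L]. The diagonal pairs i = j do sit at the kink, but
  they contribute equally to every configuration. For a strict inequality of integrands to survive
  integration, the equispaced energy must be finite. Mollification supplies this: without it the
  correlation would be of order |h| near 0, and |h| to the power - 2 s is not integrable there for s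
  \<ge> 1/2.\<close>

lemma smooth_differentiable: "smooth f \<Longrightarrow> f differentiable (at x)"
  unfolding smooth_def by (metis funpow_0)

lemma smooth_deriv: "smooth f \<Longrightarrow> smooth (deriv f)"
  unfolding smooth_def by (metis funpow_Suc_right o_apply)

lemma smooth_has_derivative: "smooth f \<Longrightarrow> (f has_real_derivative deriv f x) (at x)"
  using smooth_differentiable DERIV_deriv_iff_real_differentiable by blast

lemma smooth_continuous_on: "smooth f \<Longrightarrow> continuous_on A f"
  by (meson DERIV_continuous_on has_field_derivative_at_within smooth_has_derivative)

lemma smooth_antiderivative:
  assumes "smooth f" "\<And>x. (F has_real_derivative f x) (at x)"
  shows "smooth F"
proof -
  have d: "deriv F = f" using assms(2) DERIV_imp_deriv by blast
  have "(deriv ^^ n) F differentiable (at x)" for n x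
  proof (cases n)
    case 0 then show ?thesis using assms(2) by (auto simp: real_differentiable_def)
  next
    case (Suc m)
    then have "(deriv ^^ n) F = (deriv ^^ m) f" by (simp add: funpow_swap1 d)
    then show ?thesis using assms(1) unfolding smooth_def by metis
  qed
  then show ?thesis unfolding smooth_def by blast
qed

lemma smooth_affine:
  fixes c m b :: real
  assumes "smooth f" shows "smooth (\<lambda>x. c * f (m * x + b))"
proof -
  have d0: "((\<lambda>x. (deriv ^^ n) f (m * x + b)) has_real_derivative (deriv ^^ Suc n) f (m * x + b) * m) (at x)"
    for n x
  proof (rule DERIV_chain2[where f = "(deriv ^^ n) f"])
    show "((deriv ^^ n) f has_real_derivative (deriv ^^ Suc n) f (m * x + b)) (at (m * x + b))"
      using assms unfolding smooth_def
      by (metis DERIV_deriv_iff_real_differentiable funpow.simps(2) o_apply)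
  qed (auto intro!: derivative_eq_intros)
  have d: "((\<lambda>x. c * m ^ n * (deriv ^^ n) f (m * x + b)) has_real_derivative
      c * m ^ Suc n * (deriv ^^ Suc n) f (m * x + b)) (at x)" for n x
    using DERIV_cmult[OF d0[of n x], of "c * m ^ n"] by (simp only: power_Suc mult_ac)
  have it: "(deriv ^^ n) (\<lambda>x. c * f (m * x + b)) = (\<lambda>x. c * m ^ n * (deriv ^^ n) f (m * x + b))" for n
    by (induction n) (use DERIV_imp_deriv[OF d] in auto)
  show ?thesis unfolding smooth_def it real_differentiable_def using d by blast
qed

lemma smooth_diff:
  assumes f: "smooth f" and g: "smooth g" shows "smooth (\<lambda>x. f x - g x)"
proof -
  have it: "(deriv ^^ n) (\<lambda>x. f x - g x) = (\<lambda>x. (deriv ^^ n) f x - (deriv ^^ n) g x)" for n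
  proof (induction n)
    case (Suc n)
    have "deriv (\<lambda>x. (deriv ^^ n) f x - (deriv ^^ n) g x) x = (deriv ^^ Suc n) f x - (deriv ^^ Suc n) g x" for x
      using f g unfolding smooth_def
      by (intro DERIV_imp_deriv DERIV_diff) (auto simp: DERIV_deriv_iff_real_differentiable)
    then show ?case using Suc by auto
  qed simp
  show ?thesis using f g unfolding smooth_def it by (auto intro: differentiable_diff)
qed

lemma compact_support_bound:
  assumes "compact (closure {x::real. \<phi> x \<noteq> 0})"
  obtains M where "M > 0" "\<And>x. \<bar>x\<bar> \<ge> M \<Longrightarrow> \<phi> x = (0::real)"
proof -
  obtain B where B: "\<And>x. x \<in> closure {x. \<phi> x \<noteq> 0} \<Longrightarrow> norm x \<le> B"
    using compact_imp_bounded[OF assms] bounded_iff by metis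
  have "\<phi> x = 0" if "\<bar>x\<bar> \<ge> \<bar>B\<bar> + 1" for x
    using B[of x] closure_subset[of "{x. \<phi> x \<noteq> 0}"] that by (cases "\<phi> x = 0") auto
  then show ?thesis using that[of "\<bar>B\<bar> + 1"] by auto
qed

lemma compact_supportI:
  assumes "\<And>x. \<bar>x\<bar> > M \<Longrightarrow> \<phi> x = (0::real)"
  shows "compact (closure {x::real. \<phi> x \<noteq> 0})"
proof -
  have "{x. \<phi> x \<noteq> 0} \<subseteq> {-M..M}" using assms by (auto simp: abs_real_def not_less split: if_splits) (smt (verit))+
  then have "bounded {x. \<phi> x \<noteq> 0}" using bounded_closed_interval bounded_subset by blast
  then show ?thesis by (simp add: compact_eq_bounded_closed bounded_closure)
qed

lemma continuous_compact_support_integrable: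
  fixes g u :: "real \<Rightarrow> real"
  assumes "continuous_on UNIV g" "\<And>x. \<bar>x\<bar> > M \<Longrightarrow> g x = 0"
    and u: "set_integrable lborel {-M..M} u"
  shows "integrable lborel (\<lambda>x. g x * u x)"
proof -
  have "bounded (g ` {-M..M})"
    using assms(1) by (intro compact_imp_bounded compact_continuous_image continuous_on_subset[OF assms(1)]) auto
  then obtain B where B: "\<And>x. x \<in> {-M..M} \<Longrightarrow> \<bar>g x\<bar> \<le> B" unfolding bounded_iff by (metis image_eqI real_norm_def)
  have gm: "g \<in> borel_measurable lborel" using borel_measurable_continuous_onI[OF assms(1)] by simp
  have e: "(\<lambda>x. g x * u x) = (\<lambda>x. g x * (indicator {-M..M} x *\<^sub>R u x))"
    
  proof
    fix x show "g x * u x = g x * (indicator {-M..M} x *\<^sub>R u x)"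
      using assms(2)[of x] by (cases "\<bar>x\<bar> \<le> M") (auto simp: indicator_def)
  qed
  have ui: "integrable lborel (\<lambda>x. indicator {-M..M} x *\<^sub>R u x)" using u by (simp add: set_integrable_def)
  show ?thesis unfolding e
  proof (rule Bochner_Integration.integrable_bound[OF integrable_mult_right[OF ui, of "B"]])
    show "(\<lambda>x. g x * (indicator {-M..M} x *\<^sub>R u x)) \<in> borel_measurable lborel"
      using gm ui by measurable
    show "AE x in lborel. norm (g x * (indicator {-M..M} x *\<^sub>R u x)) \<le> norm (B * (indicator {-M..M} x *\<^sub>R u x))"
      using B 
      by (intro AE_I2) (auto simp: indicator_def abs_mult intro!: mult_right_mono intro: order_trans[OF _ abs_ge_self])
  qed
qed

text \<open>Normalised to vanish to the left of the support of \<open>g\<close>, a primitive is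
  constant to its right, and that constant is the total integral, here 0. So the primitive is itself
  a test function.\<close>

lemma test_function_primitive:
  assumes g: "smooth g" and supp: "\<And>x. \<bar>x\<bar> > M \<Longrightarrow> g x = 0" and int0: "(\<integral>x. g x \<partial>lborel) = 0"
  obtains \<phi> where "test_function \<phi>" "deriv \<phi> = g"
proof -
  have gc: "continuous_on A g" for A using g by (rule smooth_continuous_on)
  obtain G where "\<forall>x. (-\<infinity>::ereal) < ereal x \<longrightarrow> ereal x < \<infinity> \<longrightarrow> (G has_vector_derivative g x) (at x)"
    using einterval_antiderivative[of "-\<infinity>" "\<infinity>" g] gc[of UNIV]
    by (auto simp: continuous_on_eq_continuous_at)
  then have G: "(G has_real_derivative g x) (at x)" for x
    by (simp add: has_real_derivative_iff_has_vector_derivative)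
  \<comment> \<open>\<open>M\<close> may be negative, hence the \<open>max\<close>; the extra 1 puts
    \<open>-N\<close> strictly outside the support.\<close>
  define N where "N = max M 0 + 1"
  define \<phi> where "\<phi> = (\<lambda>x. G x - G (-N))"
  have \<phi>: "(\<phi> has_real_derivative g x) (at x)" for x
    unfolding \<phi>_def using DERIV_diff[OF G[of x] DERIV_const[of "G (-N)"]] by simp
  have ftc: "(\<integral>x. g x * indicator {a..b} x \<partial>lborel) = G b - G a" if "a \<le> b" for a b
    using integral_FTC_Icc_real[OF that, of G g] G gc[of UNIV]
    by (simp add: continuous_on_eq_continuous_at)
  have z: "\<phi> x = 0" if "\<bar>x\<bar> > N" for x
  proof (cases "x < 0")
    case True
    have "G (-N) - G x = (\<integral>t. g t * indicator {x..-N} t \<partial>lborel)"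
      using ftc[of x "-N"] True that by (auto simp: abs_real_def)
    also have "\<dots> = (\<integral>t. 0 \<partial>(lborel :: real measure))"
    proof (rule Bochner_Integration.integral_cong[OF refl])
      fix t show "g t * indicator {x..-N} t = (0::real)"
        using supp[of t] by (cases "\<bar>t\<bar> \<le> M") (auto simp: indicator_def N_def)
    qed
    finally show ?thesis by (simp add: \<phi>_def)
  next
    case False
    have "G x - G (-N) = (\<integral>t. g t * indicator {-N..x} t \<partial>lborel)"
      using ftc[of "-N" x] False that by (auto simp: abs_real_def N_def)
    also have "\<dots> = (\<integral>t. g t \<partial>lborel)"
    proof (rule Bochner_Integration.integral_cong)
      fix t show "g t * indicator {-N..x} t = g t"
        using supp[of t] that False by (cases "\<bar>t\<bar> \<le> M") (auto simp: indicator_def N_def)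
    qed simp
    finally show ?thesis by (simp add: \<phi>_def int0)
  qed
  show ?thesis
  proof (rule that[of \<phi>])
    show "test_function \<phi>" unfolding test_function_def
      using smooth_antiderivative[OF g \<phi>] compact_supportI[of N \<phi>] z by blast
    show "deriv \<phi> = g" using \<phi> DERIV_imp_deriv by blast
  qed
qed

lemma mollifier_smooth: "mollifier \<rho> \<Longrightarrow> smooth \<rho>"
  by (simp add: mollifier_def)

lemma rescale_shift_smooth:
  assumes "mollifier \<rho>"
  shows "smooth (\<lambda>y. rescale \<rho> \<epsilon> (x - y))"
proof -
  have "(\<lambda>y. rescale \<rho> \<epsilon> (x - y)) = (\<lambda>y. 1/\<epsilon> * \<rho> ((- 1/\<epsilon>) * y + x/\<epsilon>))"
    by (auto simp: rescale_def field_simps diff_divide_distrib)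
  then show ?thesis using smooth_affine[OF mollifier_smooth[OF assms], of "1/\<epsilon>" "-1/\<epsilon>" "x/\<epsilon>"] by simp
qed

lemma rescale_support:
  assumes "mollifier \<rho>" "\<epsilon> > 0" "\<bar>x\<bar> \<ge> \<epsilon>" shows "rescale \<rho> \<epsilon> x = 0"
proof -
  have "\<rho> y = 0" if "\<bar>y\<bar> \<ge> 1" for y
    using assms(1) that unfolding mollifier_def by (cases "\<rho> y = 0") (auto simp: subset_iff abs_real_def split: if_splits)
  then show ?thesis using assms by (auto simp: rescale_def)
qed

lemma rescale_nonneg: "mollifier \<rho> \<Longrightarrow> \<epsilon> > 0 \<Longrightarrow> rescale \<rho> \<epsilon> x \<ge> 0"
  by (auto simp: rescale_def mollifier_def)

lemma rescale_continuous:
  assumes "mollifier \<rho>" shows "continuous_on A (rescale \<rho> \<epsilon>)"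
  using smooth_continuous_on[OF smooth_affine[OF mollifier_smooth[OF assms], of "1/\<epsilon>" "1/\<epsilon>" 0], of A]
  by (simp add: rescale_def[abs_def])

lemma rescale_measurable [measurable]:
  assumes "mollifier \<rho>" shows "rescale \<rho> \<epsilon> \<in> borel_measurable borel"
  using rescale_continuous[OF assms] by (rule borel_measurable_continuous_onI)

lemma integral_rescale:
  assumes "mollifier \<rho>" "\<epsilon> > 0"
  shows "(\<integral>x. rescale \<rho> \<epsilon> x \<partial>lborel) = 1"
    and "(\<integral>y. rescale \<rho> \<epsilon> (x - y) \<partial>lborel) = 1"
proof -
  show 1: "(\<integral>x. rescale \<rho> \<epsilon> x \<partial>lborel) = 1"
    using lborel_integral_real_affine[of "1/\<epsilon>" \<rho> 0] assms by (simp add: rescale_def mollifier_def)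
  show "(\<integral>y. rescale \<rho> \<epsilon> (x - y) \<partial>lborel) = 1"
    using lborel_integral_real_affine[of "-1" "rescale \<rho> \<epsilon>" x] 1 by simp
qed

lemma integrable_mollify:
  assumes m: "mollifier \<rho>" "\<epsilon> > 0" and u: "locally_integrable u"
  shows "integrable lborel (\<lambda>y. rescale \<rho> \<epsilon> (x - y) * u y)"
proof (rule continuous_compact_support_integrable[where M = "\<bar>x\<bar> + \<epsilon>"])
  show "continuous_on UNIV (\<lambda>y. rescale \<rho> \<epsilon> (x - y))"
    using rescale_shift_smooth[OF m(1)] by (rule smooth_continuous_on)
  show "rescale \<rho> \<epsilon> (x - y) = 0" if "\<bar>y\<bar> > \<bar>x\<bar> + \<epsilon>" for y
    using rescale_support[OF m] that by auto
  show "set_integrable lborel {-(\<bar>x\<bar> + \<epsilon>)..\<bar>x\<bar> + \<epsilon>} u"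
    using u unfolding locally_integrable_def by blast
qed

lemma locally_integrable_1: "locally_integrable (\<lambda>_. 1)"
  unfolding locally_integrable_def set_integrable_def by (simp add: integrable_indicator_iff emeasure_lborel_Icc_eq)

text \<open>The difference of two values of a mollification is the pairing with the derivative of a test
  function, so it depends on the distributional derivative only.\<close>

lemma mollified_difference_unique:
  assumes m: "mollifier \<rho>" "\<epsilon> > 0"
    and u: "locally_integrable u" "has_distributional_derivative u T"
    and v: "locally_integrable v" "has_distributional_derivative v T"
  shows "convolve (rescale \<rho> \<epsilon>) u x - convolve (rescale \<rho> \<epsilon>) u z
       = convolve (rescale \<rho> \<epsilon>) v x - convolve (rescale \<rho> \<epsilon>) v z"
proof -
  let ?g = "\<lambda>y. rescale \<rho> \<epsilon> (x - y) - rescale \<rho> \<epsilon> (z - y)"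
  have "smooth ?g" by (intro smooth_diff rescale_shift_smooth m(1))
  moreover have "?g y = 0" if "\<bar>y\<bar> > \<bar>x\<bar> + \<bar>z\<bar> + \<epsilon>" for y
    using rescale_support[OF m] that by auto
  \<comment> \<open>Each of the two translates has integral 1; this cancellation makes the primitive
    of \<open>?g\<close> compactly supported.\<close>
  moreover have "(\<integral>y. ?g y \<partial>lborel) = 0"
    using integrable_mollify[OF m locally_integrable_1] integral_rescale(2)[OF m] by simp
  ultimately obtain \<phi> where \<phi>: "test_function \<phi>" "deriv \<phi> = ?g"
    by (rule test_function_primitive)
  have *: "convolve (rescale \<rho> \<epsilon>) w x - convolve (rescale \<rho> \<epsilon>) w z = - T \<phi>"
    if "locally_integrable w" "has_distributional_derivative w T" for w
  proof -
    have "convolve (rescale \<rho> \<epsilon>) w x - convolve (rescale \<rho> \<epsilon>) w z = (\<integral>y. w y * deriv \<phi> y \<partial>lborel)"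
      unfolding convolve_def \<phi>(2) using integrable_mollify[OF m that(1)]
      by (subst Bochner_Integration.integral_diff[symmetric]) (auto simp: algebra_simps)
    then show ?thesis using that(2) \<phi>(1) unfolding has_distributional_derivative_def by simp
  qed
  show ?thesis using *[OF u] *[OF v] by simp
qed

section \<open>The sawtooth potential\<close>

text \<open>It rises with slope 1 / L and drops by 1 at every multiple of L, so its derivative is 1
  / L minus the unit masses at those points. With L = \<Lambda>, the \<Lambda> translates to the
  points \<open>X i\<close> add up to a function with derivative
  \<open>dx - \<mu>\<^sup>X\<close>.\<close>

definition sawtooth :: "real \<Rightarrow> real \<Rightarrow> real" where
  "sawtooth L x = frac (x / L)"

lemma sawtooth_bounds: "0 \<le> sawtooth L x" "sawtooth L x < 1" "\<bar>sawtooth L x\<bar> \<le> 1"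
  using frac_ge_0[of "x / L"] frac_lt_1[of "x / L"] by (auto simp: sawtooth_def)

lemma sawtooth_measurable [measurable]: "sawtooth L \<in> borel_measurable borel"
  unfolding sawtooth_def[abs_def] frac_def by measurable

lemma sawtooth_plus_period: "L > 0 \<Longrightarrow> sawtooth L (x + L * of_int k) = sawtooth L x"
  by (simp add: sawtooth_def add_divide_distrib frac_def)

lemma bounded_locally_integrable:
  assumes [measurable]: "u \<in> borel_measurable borel" and "\<And>x. \<bar>u x\<bar> \<le> B"
  shows "locally_integrable u"
  unfolding locally_integrable_def set_integrable_def
proof (intro allI)
  fix a b :: real
  show "integrable lborel (\<lambda>x. indicator {a..b} x *\<^sub>R u x)"
  proof (rule Bochner_Integration.integrable_bound[of _ "\<lambda>x. B * indicator {a..b} x"])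
    show "integrable lborel (\<lambda>x. B * indicator {a..b} x)"
      by (intro integrable_mult_right) (simp add: integrable_indicator_iff emeasure_lborel_Icc_eq)
    show "AE x in lborel. norm (indicator {a..b} x *\<^sub>R u x) \<le> norm (B * indicator {a..b} x)"
      using assms(2) by (intro AE_I2) (auto simp: indicator_def intro: order_trans[OF _ abs_ge_self])
  qed measurable
qed

text \<open>On a bounded range the floor is a finite sum of unit steps, which reduces the
  distributional derivative of the sawtooth to finitely many applications of the fundamental
  theorem. Of the steps with \<open>k > - n\<close>, exactly \<open>\<lfloor>y\<rfloor> + n\<close>
  have been passed at y, whence the subtracted n.\<close>

lemma floor_eq_indicator_sum:
  fixes y :: real
  assumes "- real n \<le> y" "y < real n"
  shows "of_int \<lfloor>y\<rfloor> = (\<Sum>k\<in>{- int n<..<int n}. indicator {of_int k..} y) - real n"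
proof -
  have f: "- int n \<le> \<lfloor>y\<rfloor>" "\<lfloor>y\<rfloor> < int n" using assms by (auto simp: le_floor_iff floor_less_iff)
  have "(\<Sum>k\<in>{- int n<..<int n}. indicator {of_int k..} y) = real (card ({- int n<..<int n} \<inter> {k. of_int k \<le> y}))"
    by (simp add: indicator_def sum.If_cases)
  also have "{- int n<..<int n} \<inter> {k. of_int k \<le> y} = {- int n<..\<lfloor>y\<rfloor>}"
    using f unfolding le_floor_iff[symmetric] by auto
  also have "real (card \<dots>) = of_int \<lfloor>y\<rfloor> + real n" using f by simp
  finally show ?thesis by simp
qed

lemma deriv_eq_0_outside:
  fixes \<phi> :: "real \<Rightarrow> real"
  assumes "\<And>x. \<bar>x\<bar> \<ge> M \<Longrightarrow> \<phi> x = 0" "\<bar>x\<bar> > M"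
  shows "deriv \<phi> x = 0"
proof -
  have "(\<phi> has_real_derivative 0) (at x)"
  proof (rule DERIV_cong_ev[THEN iffD2, OF refl _ refl DERIV_const[of 0]])
    have "eventually (\<lambda>y. y \<in> {y. \<bar>y\<bar> > M}) (nhds x)"
      using assms(2) by (intro eventually_nhds_in_open open_Collect_less continuous_intros) auto
    then show "eventually (\<lambda>y. \<phi> y = 0) (nhds x)"
      by eventually_elim (use assms(1) in auto)
  qed
  then show ?thesis using DERIV_imp_deriv by blast
qed

text \<open>The pairings of the derivative with 1, with x and with a unit step are the ingredients
  into which the sawtooth decomposes on the support of \<phi>.\<close>

lemma test_function_integrals:
  assumes "test_function \<phi>"
  shows "integrable lborel \<phi>"
    and "integrable lborel (deriv \<phi>)"
    and "integrable lborel (\<lambda>x. deriv \<phi> x * x)"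
    and "(\<integral>x. deriv \<phi> x * indicator {c..} x \<partial>lborel) = - \<phi> c"
    and "(\<integral>x. deriv \<phi> x * x \<partial>lborel) = - (\<integral>x. \<phi> x \<partial>lborel)"
    and "(\<integral>x. deriv \<phi> x \<partial>lborel) = 0"
    and "integrable lborel (\<lambda>x. deriv \<phi> x * indicator {c..} x)"
proof -
  obtain M where M: "M > 0" "\<And>x. \<bar>x\<bar> \<ge> M \<Longrightarrow> \<phi> x = 0"
    using assms compact_support_bound unfolding test_function_def by metis
  have sm: "smooth \<phi>" using assms by (simp add: test_function_def)
  note d = smooth_has_derivative[OF sm]
  have c\<phi>: "continuous_on A \<phi>" and cd: "continuous_on A (deriv \<phi>)" for A
    using smooth_continuous_on sm smooth_deriv by blast+
  note dz = deriv_eq_0_outside[of M \<phi>, OF M(2)]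
  have li: "set_integrable lborel {-M..M} (\<lambda>x. u x)" if "continuous_on UNIV u" for u :: "real \<Rightarrow> real"
    using borel_integrable_compact[of "{-M..M}" u] continuous_on_subset[OF that]
    by (simp add: set_integrable_def indicator_scaleR_eq_if)
  have i: "integrable lborel (\<lambda>x. g x * u x)"
    if "continuous_on UNIV g" "\<And>x. \<bar>x\<bar> > M \<Longrightarrow> g x = 0" "continuous_on UNIV u" for g u :: "real \<Rightarrow> real"
    using continuous_compact_support_integrable[OF that(1,2) li[OF that(3)]] .
  show i\<phi>: "integrable lborel \<phi>" using i[of \<phi> "\<lambda>_. 1"] c\<phi> M by simp
  show id: "integrable lborel (deriv \<phi>)" using i[of "deriv \<phi>" "\<lambda>_. 1"] cd dz by simp
  show ix: "integrable lborel (\<lambda>x. deriv \<phi> x * x)" using i[of "deriv \<phi>" "\<lambda>x. x"] cd dz by simp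
  show "integrable lborel (\<lambda>x. deriv \<phi> x * indicator {c..} x)"
    using integrable_mult_indicator[of "{c..}" lborel "deriv \<phi>"] id by (simp add: mult_ac)
  have ftc: "(\<integral>x. g x * indicator {a..b} x \<partial>lborel) = G b - G a"
    if "a \<le> b" "\<And>x. (G has_real_derivative g x) (at x)" "continuous_on UNIV g" for a b and g G :: "real \<Rightarrow> real"
    using integral_FTC_Icc_real[OF that(1,2)] that(3)
    by (simp add: continuous_on_eq_continuous_at)
  show "(\<integral>x. deriv \<phi> x * indicator {c..} x \<partial>lborel) = - \<phi> c"
  proof -
    have "(\<integral>x. deriv \<phi> x * indicator {c..} x \<partial>lborel) = (\<integral>x. deriv \<phi> x * indicator {c..\<bar>c\<bar> + M + 1} x \<partial>lborel)"
    proof (rule Bochner_Integration.integral_cong[OF refl])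
      fix x show "deriv \<phi> x * indicator {c..} x = deriv \<phi> x * indicator {c..\<bar>c\<bar> + M + 1} x"
        using dz[of x] by (cases "\<bar>x\<bar> \<le> M") (auto simp: indicator_def)
    qed
    also have "\<dots> = - \<phi> c" using ftc[OF _ d cd, of c "\<bar>c\<bar> + M + 1"] M by simp
    finally show ?thesis .
  qed
  have whole: "(\<integral>x. g x \<partial>lborel) = 0"
    if "\<And>x. (G has_real_derivative g x) (at x)" "continuous_on UNIV g"
       "\<And>x. \<bar>x\<bar> > M \<Longrightarrow> g x = 0" "G M = 0" "G (-M) = 0" for g G :: "real \<Rightarrow> real"
  proof -
    have "(\<integral>x. g x \<partial>lborel) = (\<integral>x. g x * indicator {-M..M} x \<partial>lborel)"
    proof (rule Bochner_Integration.integral_cong[OF refl])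
      fix x show "g x = g x * indicator {-M..M} x"
        using that(3)[of x] by (cases "\<bar>x\<bar> \<le> M") (auto simp: indicator_def)
    qed
    then show ?thesis using ftc[OF _ that(1,2), of "-M" M] that(4,5) M(1) by simp
  qed
  show "(\<integral>x. deriv \<phi> x \<partial>lborel) = 0"
    by (rule whole[OF d cd dz]) (use M in auto)
  have "(\<integral>x. deriv \<phi> x * x + \<phi> x \<partial>lborel) = 0"
  proof (rule whole[where G = "\<lambda>x. \<phi> x * x"])
    show "((\<lambda>x. \<phi> x * x) has_real_derivative deriv \<phi> x * x + \<phi> x) (at x)" for x
      by (auto intro!: derivative_eq_intros d)
    show "continuous_on UNIV (\<lambda>x. deriv \<phi> x * x + \<phi> x)" by (intro continuous_intros cd c\<phi>)
  qed (use M dz in auto)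
  then show "(\<integral>x. deriv \<phi> x * x \<partial>lborel) = - (\<integral>x. \<phi> x \<partial>lborel)"
    using ix i\<phi> by simp
qed

text \<open>On the support of \<phi> the sawtooth is an affine function of slope 1 / L minus
  finitely many unit steps; each step yields the value of \<phi> at its jump, the affine part yields
  the integral of \<phi> over L with a minus sign. The range of k is exported because the point
  measure is later evaluated over the same range.\<close>

lemma sawtooth_distributional:
  assumes "L > 0" "test_function \<phi>"
  obtains N where "\<And>k. \<phi> (p + L * of_int k) \<noteq> 0 \<Longrightarrow> k \<in> {- int N<..<int N}"
    and "(\<integral>x. sawtooth L (x - p) * deriv \<phi> x \<partial>lborel)
       = (\<Sum>k\<in>{- int N<..<int N}. \<phi> (p + L * of_int k)) - (\<integral>x. \<phi> x \<partial>lborel) / L"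
proof -
  obtain M where M: "M > 0" "\<And>x. \<bar>x\<bar> \<ge> M \<Longrightarrow> \<phi> x = 0"
    using assms compact_support_bound unfolding test_function_def by metis
  note T = test_function_integrals[OF assms(2)]
  \<comment> \<open>Large enough that (x - p) / L lies in [-N, N) whenever |x| \<le> M, as the floor
    formula requires.\<close>
  obtain N where N: "real N > (M + \<bar>p\<bar>) / L" using reals_Archimedean2 by blast
  then have NL: "M + \<bar>p\<bar> < real N * L" using assms(1) by (simp add: field_simps)
  note dz = deriv_eq_0_outside[of M \<phi>, OF M(2)]
  have a: "k \<in> {- int N<..<int N}" if "\<phi> (p + L * of_int k) \<noteq> 0" for k
  proof -
    have "\<bar>p + L * of_int k\<bar> < M" using M(2) that not_le by blast
    then have "\<bar>L * of_int k\<bar> < real N * L" using NL by linarith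
    then have "L * \<bar>real_of_int k\<bar> < L * real N" using assms(1) by (simp add: abs_mult mult_ac)
    then have "\<bar>k\<bar> < int N" using assms(1) by (simp add: mult_less_cancel_left)
    then show ?thesis by auto
  qed
  let ?K = "{- int N<..<int N}"
  define I where "I = (\<lambda>k x. deriv \<phi> x * indicator {p + L * of_int k..} x)"
  have "sawtooth L (x - p) * deriv \<phi> x = (deriv \<phi> x * x) / L + (real N - p / L) * deriv \<phi> x
      - (\<Sum>k\<in>?K. deriv \<phi> x * indicator {p + L * of_int k..} x)" for x
  proof (cases "\<bar>x\<bar> > M")
    case False
    then have "- real N \<le> (x - p) / L" "(x - p) / L < real N"
      using NL assms(1) by (auto simp: field_simps abs_real_def split: if_splits)
    from floor_eq_indicator_sum[OF this]
    have "sawtooth L (x - p) = (x - p) / L - (\<Sum>k\<in>?K. indicator {of_int k..} ((x - p) / L)) + real N"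
      by (simp add: sawtooth_def frac_def)
    also have "(\<Sum>k\<in>?K. indicator {of_int k..} ((x - p) / L) :: real)
       = (\<Sum>k\<in>?K. indicator {p + L * of_int k..} x)"
      using assms(1) by (intro sum.cong) (auto simp: indicator_def field_simps)
    finally have "sawtooth L (x - p)
      = (x - p) / L - (\<Sum>k\<in>?K. indicator {p + L * of_int k..} x) + real N" .
    then show ?thesis by (simp only: sum_distrib_left[symmetric]) (simp add: algebra_simps diff_divide_distrib)
  qed (use dz in auto)
  then have e: "(\<lambda>x. sawtooth L (x - p) * deriv \<phi> x)
     = (\<lambda>x. (deriv \<phi> x * x) / L + (real N - p / L) * deriv \<phi> x - (\<Sum>k\<in>?K. I k x))"
    unfolding I_def by (rule ext)
  have "integrable lborel (I k)" "(\<integral>x. I k x \<partial>lborel) = - \<phi> (p + L * of_int k)" for k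
    unfolding I_def using T(4,7) by auto
  then have "(\<integral>x. sawtooth L (x - p) * deriv \<phi> x \<partial>lborel)
     = - (\<integral>x. \<phi> x \<partial>lborel) / L + (\<Sum>k\<in>?K. \<phi> (p + L * of_int k))"
    unfolding e using T(1,2,3,5,6) by (simp add: sum_negf)
  then show ?thesis using that[OF a] by simp
qed

text \<open>An explicit bounded Borel representative of \<open>u\<^sup>X\<close>.\<close>

definition sawtooth_sum :: "nat \<Rightarrow> (nat \<Rightarrow> real) \<Rightarrow> real \<Rightarrow> real" where
  "sawtooth_sum \<Lambda> X x = (\<Sum>i\<in>{1..\<Lambda>}. sawtooth (real \<Lambda>) (x - X i))"

lemma sawtooth_sum_measurable [measurable]: "sawtooth_sum \<Lambda> X \<in> borel_measurable borel"
  unfolding sawtooth_sum_def[abs_def] by measurable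

lemma sawtooth_sum_bound: "\<bar>sawtooth_sum \<Lambda> X x\<bar> \<le> real \<Lambda>"
proof -
  have "\<bar>sawtooth_sum \<Lambda> X x\<bar> \<le> (\<Sum>i\<in>{1..\<Lambda>}. 1)"
    unfolding sawtooth_sum_def by (intro order_trans[OF sum_abs] sum_mono sawtooth_bounds)
  then show ?thesis by simp
qed

lemma sawtooth_sum_locally_integrable: "locally_integrable (sawtooth_sum \<Lambda> X)"
  by (rule bounded_locally_integrable[OF _ sawtooth_sum_bound]) measurable

text \<open>The range \<open>K i\<close> may depend on i because the window of relevant periods
  does: it is the range of \<open>sawtooth_distributional\<close> at p = \<open>X i\<close>, or the
  window cut out by an interval (a, b).\<close>

lemma integral_point_measure:
  fixes \<phi> :: "real \<Rightarrow> real"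
  assumes "\<phi> \<in> borel_measurable borel"
    and "\<And>i k. i \<in> {1..\<Lambda>} \<Longrightarrow> \<phi> (X i + real \<Lambda> * of_int k) \<noteq> 0 \<Longrightarrow> k \<in> K i"
    and "\<And>i. finite (K i)"
  shows "(\<integral>x. \<phi> x \<partial>point_measure \<Lambda> X) = (\<Sum>i\<in>{1..\<Lambda>}. \<Sum>k\<in>K i. \<phi> (X i + real \<Lambda> * of_int k))"
proof -
  let ?f = "\<lambda>(i, k). X i + real \<Lambda> * of_int k" and ?C = "{1..\<Lambda>} \<times> (UNIV :: int set)"
  let ?S = "{p \<in> ?C. \<phi> (?f p) \<noteq> 0}"
  have fin: "finite (Sigma {1..\<Lambda>} K)" using assms(3) by auto
  have sub: "?S \<subseteq> Sigma {1..\<Lambda>} K" using assms(2) by auto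
  have "(\<integral>x. \<phi> x \<partial>point_measure \<Lambda> X) = (\<integral>p. \<phi> (?f p) \<partial>count_space ?C)"
    unfolding point_measure_def using assms(1) by (subst integral_distr) (auto simp: split_beta)
  also have "\<dots> = (\<Sum>p\<in>?S. \<phi> (?f p))"
    using finite_subset[OF sub fin] by (rule lebesgue_integral_count_space_finite_support)
  also have "\<dots> = (\<Sum>p\<in>Sigma {1..\<Lambda>} K. \<phi> (?f p))"
    by (rule sum.mono_neutral_left[OF fin sub]) auto
  also have "\<dots> = (\<Sum>i\<in>{1..\<Lambda>}. \<Sum>k\<in>K i. \<phi> (X i + real \<Lambda> * of_int k))"
    by (subst sum.Sigma) (use assms in \<open>auto simp: split_beta\<close>)
  finally show ?thesis .
qed

lemma test_function_measurable: "test_function \<phi> \<Longrightarrow> \<phi> \<in> borel_measurable borel"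
  using test_function_integrals(1) borel_measurable_integrable by force

lemma sawtooth_sum_distributional:
  assumes "\<Lambda> \<ge> 1"
  shows "has_distributional_derivative (sawtooth_sum \<Lambda> X)
       (\<lambda>\<phi>. (\<integral>x. \<phi> x \<partial>lborel) - (\<integral>x. \<phi> x \<partial>point_measure \<Lambda> X))"
  unfolding has_distributional_derivative_def
proof (intro allI impI)
  fix \<phi> assume t: "test_function \<phi>"
  define L where "L = real \<Lambda>"
  have L: "L > 0" using assms by (simp add: L_def)
  have "\<forall>p. \<exists>N. (\<forall>k. \<phi> (p + L * of_int k) \<noteq> 0 \<longrightarrow> k \<in> {- int N<..<int N}) \<and>
    (\<integral>x. sawtooth L (x - p) * deriv \<phi> x \<partial>lborel)
       = (\<Sum>k\<in>{- int N<..<int N}. \<phi> (p + L * of_int k)) - (\<integral>x. \<phi> x \<partial>lborel) / L"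
    using sawtooth_distributional[OF L t] by (intro allI) metis
  from choice[OF this] obtain N where N:
    "\<And>p k. \<phi> (p + L * of_int k) \<noteq> 0 \<Longrightarrow> k \<in> {- int (N p)<..<int (N p)}"
    "\<And>p. (\<integral>x. sawtooth L (x - p) * deriv \<phi> x \<partial>lborel)
       = (\<Sum>k\<in>{- int (N p)<..<int (N p)}. \<phi> (p + L * of_int k)) - (\<integral>x. \<phi> x \<partial>lborel) / L"
    by blast
  have int: "integrable lborel (\<lambda>x. sawtooth L (x - p) * deriv \<phi> x)" for p
  proof (rule Bochner_Integration.integrable_bound[OF test_function_integrals(2)[OF t]])
    show "(\<lambda>x. sawtooth L (x - p) * deriv \<phi> x) \<in> borel_measurable lborel"
      using borel_measurable_integrable[OF test_function_integrals(2)[OF t]] by measurable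
    show "AE x in lborel. norm (sawtooth L (x - p) * deriv \<phi> x) \<le> norm (deriv \<phi> x)"
      using sawtooth_bounds(3) by (intro AE_I2) (simp add: abs_mult mult_left_le_one_le)
  qed
  have "(\<integral>x. sawtooth_sum \<Lambda> X x * deriv \<phi> x \<partial>lborel) = (\<Sum>i\<in>{1..\<Lambda>}. \<integral>x. sawtooth L (x - X i) * deriv \<phi> x \<partial>lborel)"
    unfolding sawtooth_sum_def sum_distrib_right L_def[symmetric] using int by simp
  \<comment> \<open>The \<Lambda> densities 1 / L add up to 1.\<close>
  also have "\<dots> = (\<Sum>i\<in>{1..\<Lambda>}. \<Sum>k\<in>{- int (N (X i))<..<int (N (X i))}. \<phi> (X i + L * of_int k)) - (\<integral>x. \<phi> x \<partial>lborel)"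
    unfolding N(2) sum_subtractf using L by (simp add: L_def)
  also have "(\<Sum>i\<in>{1..\<Lambda>}. \<Sum>k\<in>{- int (N (X i))<..<int (N (X i))}. \<phi> (X i + L * of_int k)) = (\<integral>x. \<phi> x \<partial>point_measure \<Lambda> X)"
    unfolding L_def
    by (rule integral_point_measure[symmetric]) (use test_function_measurable[OF t] N(1) in \<open>auto simp: L_def\<close>)
  finally show "(\<integral>x. sawtooth_sum \<Lambda> X x * deriv \<phi> x \<partial>lborel)
     = - ((\<integral>x. \<phi> x \<partial>lborel) - (\<integral>x. \<phi> x \<partial>point_measure \<Lambda> X))" by simp
qed

text \<open>By \<open>sawtooth_sum_distributional\<close> the pairing is the point measure of \<phi>
  minus its Lebesgue integral. For |\<phi>| \<le> 1 supported in (a, b), the former is at most a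
  number of points and the latter is bounded by the length of the interval.\<close>

lemma sawtooth_sum_BV_loc:
  assumes "\<Lambda> \<ge> 1"
  shows "sawtooth_sum \<Lambda> X \<in> BV_loc"
  unfolding BV_loc_def
proof (intro CollectI conjI allI sawtooth_sum_locally_integrable)
  fix a b :: real
  define L where "L = real \<Lambda>"
  have L: "L > 0" using assms by (simp add: L_def)
  \<comment> \<open>Contains every period whose translate of \<open>X i\<close> can fall into (a,
    b), uniformly in \<phi>.\<close>
  define K where "K = (\<lambda>i. {\<lfloor>(a - X i) / L\<rfloor>..\<lceil>(b - X i) / L\<rceil>})"
  show "bdd_above {\<integral>x. sawtooth_sum \<Lambda> X x * deriv \<phi> x \<partial>lborel | \<phi>.
        test_function \<phi> \<and> closure {x. \<phi> x \<noteq> 0} \<subseteq> {a<..<b} \<and> (\<forall>x. \<bar>\<phi> x\<bar> \<le> 1)}"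
  proof (rule bdd_aboveI, clarify)
    fix \<phi> assume t: "test_function \<phi>" and sub: "closure {x. \<phi> x \<noteq> 0} \<subseteq> {a<..<b}" and bd: "\<forall>x. \<bar>\<phi> x\<bar> \<le> 1"
    have z: "\<phi> x \<noteq> 0 \<Longrightarrow> a < x \<and> x < b" for x using sub closure_subset[of "{x. \<phi> x \<noteq> 0}"] by auto
    have "(\<integral>x. \<phi> x \<partial>point_measure \<Lambda> X) = (\<Sum>i\<in>{1..\<Lambda>}. \<Sum>k\<in>K i. \<phi> (X i + real \<Lambda> * of_int k))"
    proof (rule integral_point_measure[OF test_function_measurable[OF t]])
      fix i k assume "\<phi> (X i + real \<Lambda> * of_int k) \<noteq> 0"
      from z[OF this] have "(a - X i) / L \<le> of_int k" "of_int k \<le> (b - X i) / L"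
        using L by (auto simp: field_simps L_def)
      then show "k \<in> K i" unfolding K_def by (auto simp: floor_le_iff le_ceiling_iff; linarith)
    qed (auto simp: K_def)
    also have "\<dots> \<le> (\<Sum>i\<in>{1..\<Lambda>}. \<Sum>k\<in>K i. 1)"
      using bd by (intro sum_mono) (auto simp: abs_le_iff)
    finally have 1: "(\<integral>x. \<phi> x \<partial>point_measure \<Lambda> X) \<le> (\<Sum>i\<in>{1..\<Lambda>}. \<Sum>k\<in>K i. 1)" .
    have "\<bar>\<integral>x. \<phi> x \<partial>lborel\<bar> \<le> (\<integral>x. \<bar>\<phi> x\<bar> \<partial>lborel)" by (rule integral_abs_bound)
    also have "\<dots> \<le> (\<integral>x. indicator {a..b} x \<partial>lborel)"
    proof (rule integral_mono)
      show "\<bar>\<phi> x\<bar> \<le> indicator {a..b} x" for x using z[of x] bd by (cases "\<phi> x = 0") (auto simp: indicator_def)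
    qed (use test_function_integrals(1)[OF t] in \<open>auto simp: integrable_indicator_iff emeasure_lborel_Icc_eq\<close>)
    finally have 2: "\<bar>\<integral>x. \<phi> x \<partial>lborel\<bar> \<le> (\<integral>x. indicator {a..b} x \<partial>lborel)" .
    have "(\<integral>x. sawtooth_sum \<Lambda> X x * deriv \<phi> x \<partial>lborel) = - ((\<integral>x. \<phi> x \<partial>lborel) - (\<integral>x. \<phi> x \<partial>point_measure \<Lambda> X))"
      using sawtooth_sum_distributional[OF assms] t unfolding has_distributional_derivative_def by blast
    with 1 2 show "(\<integral>x. sawtooth_sum \<Lambda> X x * deriv \<phi> x \<partial>lborel)
       \<le> (\<integral>x. indicator {a..b} x \<partial>lborel) + (\<Sum>i\<in>{1..\<Lambda>}. \<Sum>k\<in>K i. 1)" by linarith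
  qed
qed

text \<open>The chosen \<open>potential\<close> is known only through its specification.
  \<open>sawtooth_sum\<close> shows that the specification can be met, so the choice meets it too,
  and uniqueness of mollified differences transfers everything to the explicit function.\<close>

lemma mollified_potential_difference:
  assumes "mollifier \<rho>" "\<epsilon> > 0" "\<Lambda> \<ge> 1"
  shows "mollified_potential \<rho> \<epsilon> \<Lambda> X x - mollified_potential \<rho> \<epsilon> \<Lambda> X y
    = convolve (rescale \<rho> \<epsilon>) (sawtooth_sum \<Lambda> X) x - convolve (rescale \<rho> \<epsilon>) (sawtooth_sum \<Lambda> X) y"
proof -
  let ?T = "\<lambda>\<phi>. (\<integral>x. \<phi> x \<partial>lborel) - (\<integral>x. \<phi> x \<partial>point_measure \<Lambda> X)"
  have "potential \<Lambda> X \<in> BV_loc \<and> has_distributional_derivative (potential \<Lambda> X) ?T"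
    unfolding potential_def
    by (rule someI[of _ "sawtooth_sum \<Lambda> X"])
       (use sawtooth_sum_BV_loc sawtooth_sum_distributional assms in blast)
  then show ?thesis unfolding mollified_potential_def
    using sawtooth_sum_locally_integrable sawtooth_sum_distributional[OF assms(3)]
    by (intro mollified_difference_unique[OF assms(1,2), where T = ?T]) (auto simp: BV_loc_def)
qed

section \<open>Correlations of sawtooth increments\<close>

lemma sawtooth_eqI:
  assumes "L > 0" "of_int k * L \<le> x" "x < of_int (k + 1) * L"
  shows "sawtooth L x = x / L - of_int k"
proof -
  have "\<lfloor>x / L\<rfloor> = k"
    using assms by (intro floor_unique) (auto simp: field_simps)
  then show ?thesis by (simp add: sawtooth_def frac_def)
qed

lemma sawtooth_repr:
  assumes "L > 0"
  obtains k :: int where "x = L * sawtooth L x + L * of_int k"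
  using that[of "\<lfloor>x / L\<rfloor>"] assms by (simp add: sawtooth_def frac_def right_diff_distrib)

definition period_measure :: "real \<Rightarrow> real measure" where
  "period_measure L = density lborel (indicator {0..<L})"

lemma sets_period_measure [measurable_cong, simp]: "sets (period_measure L) = sets borel"
  by (simp add: period_measure_def)

lemma emeasure_lborel_Ico_finite: "emeasure lborel {a..<b::real} < \<infinity>"
  by (cases "a \<le> b") auto

lemma finite_period_measure: "finite_measure (period_measure L)"
  using emeasure_lborel_Ico_finite[of 0 L]
  by (intro finite_measureI) (auto simp: period_measure_def emeasure_density)

lemma integral_period_measure:
  fixes f :: "real \<Rightarrow> real"
  assumes "f \<in> borel_measurable borel"
  shows "(\<integral>x. f x \<partial>period_measure L) = (\<integral>x. indicator {0..<L} x * f x \<partial>lborel)"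
  using integral_density[of f lborel "indicator {0..<L}"] assms
  by (simp add: period_measure_def ennreal_indicator)

lemma bounded_integrable_Ico:
  fixes f :: "real \<Rightarrow> real"
  assumes [measurable]: "f \<in> borel_measurable borel" and "\<And>x. \<bar>f x\<bar> \<le> B"
  shows "integrable lborel (\<lambda>x. indicator {a..<b} x * f x)"
proof (rule Bochner_Integration.integrable_bound[of _ "\<lambda>x. B * indicator {a..<b} x"])
  show "integrable lborel (\<lambda>x. B * indicator {a..<b} x)"
    by (intro integrable_mult_right) (simp add: integrable_indicator_iff emeasure_lborel_Ico_finite[unfolded infinity_ennreal_def])
  show "AE x in lborel. norm (indicator {a..<b} x * f x) \<le> norm (B * indicator {a..<b} x)"
    using assms(2) by (intro AE_I2) (auto simp: indicator_def intro: order_trans[OF _ abs_ge_self])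
qed measurable

text \<open>The shift acts only through its remainder r modulo L. The window moved by r sticks out
  of [0, L) by a piece of length r, which translation by one period puts back.\<close>

lemma integral_period_shift:
  fixes f :: "real \<Rightarrow> real"
  assumes L: "L > 0" and [measurable]: "f \<in> borel_measurable borel" and B: "\<And>x. \<bar>f x\<bar> \<le> B"
    and per: "\<And>x k. f (x + L * of_int k) = f x"
  shows "(\<integral>x. f (x - p) \<partial>period_measure L) = (\<integral>x. f x \<partial>period_measure L)"
proof -
  define r where "r = L * sawtooth L p"
  obtain k where k: "p = r + L * of_int k" using sawtooth_repr[OF L] r_def by metis
  have r: "0 \<le> r" "r < L" using sawtooth_bounds[of L p] L by (auto simp: r_def)
  have fp: "f (x - p) = f (x - r)" for x
    using per[of "x - r" "-k"] k by (simp add: algebra_simps)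
  have tr: "(\<integral>x. g x \<partial>lborel) = (\<integral>x. g (x + c) \<partial>lborel)" for g :: "real \<Rightarrow> real" and c
    using lborel_integral_real_affine[of 1 g c] by (simp add: add.commute)
  note I = bounded_integrable_Ico[of f B, OF _ B]
  have "(\<integral>x. f (x - p) \<partial>period_measure L) = (\<integral>x. indicator {0..<L} x * f (x - r) \<partial>lborel)"
    by (simp add: integral_period_measure fp)
  also have "\<dots> = (\<integral>x. indicator {0..<L} (x + r) * f x \<partial>lborel)"
    by (subst tr[where c = r]) simp
  also have "\<dots> = (\<integral>x. indicator {-r..<0} x * f x + indicator {0..<L-r} x * f x \<partial>lborel)"
    by (intro Bochner_Integration.integral_cong refl) (use r in \<open>auto simp: indicator_def\<close>)
  also have "\<dots> = (\<integral>x. indicator {-r..<0} x * f x \<partial>lborel) + (\<integral>x. indicator {0..<L-r} x * f x \<partial>lborel)"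
    using I by (intro Bochner_Integration.integral_add) auto
  also have "(\<integral>x. indicator {-r..<0} x * f x \<partial>lborel) = (\<integral>x. indicator {L-r..<L} x * f x \<partial>lborel)"
    by (subst tr[where c = "-L"], intro Bochner_Integration.integral_cong refl)
       (use per[of _ "-1"] in \<open>auto simp: indicator_def\<close>)
  also have "\<dots> + (\<integral>x. indicator {0..<L-r} x * f x \<partial>lborel)
      = (\<integral>x. indicator {L-r..<L} x * f x + indicator {0..<L-r} x * f x \<partial>lborel)"
    using I by (intro Bochner_Integration.integral_add[symmetric]) auto
  also have "\<dots> = (\<integral>x. indicator {0..<L} x * f x \<partial>lborel)"
    by (intro Bochner_Integration.integral_cong refl) (use r in \<open>auto simp: indicator_def\<close>)
  also have "\<dots> = (\<integral>x. f x \<partial>period_measure L)" by (simp add: integral_period_measure)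
  finally show ?thesis .
qed

lemma integral_FTC_Ico:
  fixes f F :: "real \<Rightarrow> real"
  assumes "a \<le> b" "\<And>x. (F has_real_derivative f x) (at x)" "continuous_on UNIV f"
  shows "(\<integral>x. indicator {a..<b} x * f x \<partial>lborel) = F b - F a"
proof -
  have [measurable]: "f \<in> borel_measurable borel" using assms(3) by (rule borel_measurable_continuous_onI)
  have "(\<integral>x. indicator {a..<b} x * f x \<partial>lborel) = (\<integral>x. f x * indicator {a..b} x \<partial>lborel)"
  proof (rule integral_cong_AE)
    show "AE x in lborel. indicator {a..<b} x * f x = f x * indicator {a..b} x"
      using AE_lborel_singleton[of b] by eventually_elim (auto simp: indicator_def)
  qed measurable
  also have "\<dots> = F b - F a"
    using integral_FTC_Icc_real[OF assms(1,2)] assms(3) by (simp add: continuous_on_eq_continuous_at)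
  finally show ?thesis .
qed

text \<open>The autocorrelation of the sawtooth, minus its value \<open>L / 3\<close> at the origin.\<close>

definition sawtooth_corr :: "real \<Rightarrow> real \<Rightarrow> real" where
  "sawtooth_corr L t = L * ((sawtooth L t)\<^sup>2 - sawtooth L t) / 2"

lemma sawtooth_corr_measurable [measurable]: "sawtooth_corr L \<in> borel_measurable borel"
  unfolding sawtooth_corr_def[abs_def] by measurable

text \<open>By translation invariance only the remainder r of p - q modulo L matters. On [0, L) the
  second factor is (x + r) / L with a single drop by 1 at x = L - r, so the integral is that of a
  polynomial over the full period minus a correction over [L - r, L).\<close>

lemma sawtooth_product_integral:
  assumes L: "L > 0"
  shows "(\<integral>x. sawtooth L (x - p) * sawtooth L (x - q) \<partial>period_measure L) = sawtooth_corr L (p - q) + L / 3"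
proof -
  define t where "t = p - q"
  define r where "r = L * sawtooth L t"
  obtain k where k: "t = r + L * of_int k" using sawtooth_repr[OF L] r_def by metis
  have r: "0 \<le> r" "r < L" using sawtooth_bounds[of L t] L by (auto simp: r_def)
  have st: "sawtooth L (y + t) = sawtooth L (y + r)" for y
    using sawtooth_plus_period[OF L, of "y + r" k] k by (simp add: algebra_simps)
  let ?g = "\<lambda>y. sawtooth L y * sawtooth L (y + t)"
  have "(\<integral>x. sawtooth L (x - p) * sawtooth L (x - q) \<partial>period_measure L) = (\<integral>x. ?g (x - p) \<partial>period_measure L)"
    by (simp add: t_def)
  also have "\<dots> = (\<integral>x. ?g x \<partial>period_measure L)"
  proof (rule integral_period_shift[OF L, where B = 1])
    show "\<bar>?g x\<bar> \<le> 1" for x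
      using mult_mono[OF sawtooth_bounds(3)[of L x] sawtooth_bounds(3)[of L "x+t"]] by (simp add: abs_mult)
    show "?g (x + L * of_int k) = ?g x" for x k
      using sawtooth_plus_period[OF L, of x k] sawtooth_plus_period[OF L, of "x + t" k]
      by (simp add: algebra_simps)
  qed measurable
  also have "\<dots> = (\<integral>x. indicator {0..<L} x * ((x / L) * ((x + r) / L)) - indicator {L-r..<L} x * (x / L) \<partial>lborel)"
  proof (subst integral_period_measure, measurable, intro Bochner_Integration.integral_cong refl)
    fix x
    have "sawtooth L x = x / L" if "0 \<le> x" "x < L"
      using sawtooth_eqI[OF L, of 0 x] that by simp
    moreover have "sawtooth L (x + r) = (x + r) / L" if "0 \<le> x" "x < L - r"
      using sawtooth_eqI[OF L, of 0 "x + r"] that r by simp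
    moreover have "sawtooth L (x + r) = (x + r) / L - 1" if "x < L" "L - r \<le> x"
      using sawtooth_eqI[OF L, of 1 "x + r"] that r by simp
    ultimately show "indicator {0..<L} x * ?g x
        = indicator {0..<L} x * ((x / L) * ((x + r) / L)) - indicator {L-r..<L} x * (x / L)"
      unfolding st using r L by (auto simp: indicator_def) (simp_all add: field_simps)
  qed
  also have "\<dots> = (\<integral>x. indicator {0..<L} x * ((x / L) * ((x + r) / L)) \<partial>lborel) - (\<integral>x. indicator {L-r..<L} x * (x / L) \<partial>lborel)"
  proof (rule Bochner_Integration.integral_diff)
    have "integrable lborel (\<lambda>x. indicator {a..<b} x * f x)" if "continuous_on {a..b} f" for a b and f :: "real \<Rightarrow> real"
    proof -
      have "integrable lborel (\<lambda>x. indicator {a..b} x *\<^sub>R f x)"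
        using borel_integrable_compact[of "{a..b}" f] that by (simp add: indicator_scaleR_eq_if)
      from integrable_mult_indicator[OF _ this, of "{a..<b}"]
      show ?thesis by (rule Bochner_Integration.integrable_cong[THEN iffD1, rotated -1]) (auto simp: indicator_def)
    qed
    note I = this
    show "integrable lborel (\<lambda>x. indicator {0..<L} x * ((x / L) * ((x + r) / L)))"
      "integrable lborel (\<lambda>x. indicator {L-r..<L} x * (x / L))"
      using L by (intro I continuous_intros; simp)+
  qed
  also have "(\<integral>x. indicator {0..<L} x * ((x / L) * ((x + r) / L)) \<partial>lborel) = L / 3 + r / 2"
    using L by (subst integral_FTC_Ico[where F = "\<lambda>x. (x^3 / 3 + r * x\<^sup>2 / 2) / L\<^sup>2"])
      (auto intro!: derivative_eq_intros continuous_intros simp: field_simps power2_eq_square power3_eq_cube)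
  also have "(\<integral>x. indicator {L-r..<L} x * (x / L) \<partial>lborel) = r - r\<^sup>2 / (2 * L)"
    using L r by (subst integral_FTC_Ico[where F = "\<lambda>x. x\<^sup>2 / (2 * L)"])
      (auto intro!: derivative_eq_intros continuous_intros simp: field_simps power2_eq_square)
  finally show ?thesis
    unfolding sawtooth_corr_def t_def[symmetric] using L by (simp add: r_def field_simps power2_eq_square)
qed

text \<open>The function \<open>A h t\<close> of the overview: the correlation over one period of
  the increments with step h of two sawtooths whose jumps are t apart. It is minus the second
  difference of \<open>sawtooth_corr\<close> with step h.\<close>

definition increment_corr :: "real \<Rightarrow> real \<Rightarrow> real \<Rightarrow> real" where
  "increment_corr L h t = 2 * sawtooth_corr L t - sawtooth_corr L (t + h) - sawtooth_corr L (t - h)"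

text \<open>Expanding the product gives four correlations with signs +, -, -, +, so the constant L /
  3 cancels.\<close>

lemma increment_corr_integral:
  assumes L: "L > 0"
  shows "(\<integral>x. (sawtooth L (x - p + h) - sawtooth L (x - p)) * (sawtooth L (x - q + h) - sawtooth L (x - q)) \<partial>period_measure L)
     = increment_corr L h (p - q)"
proof -
  interpret finite_measure "period_measure L" by (rule finite_period_measure)
  have I: "integrable (period_measure L) (\<lambda>x. sawtooth L (x - a) * sawtooth L (x - b))" for a b
  proof (rule integrable_const_bound[of _ 1])
    show "AE x in period_measure L. norm (sawtooth L (x - a) * sawtooth L (x - b)) \<le> 1"
      using mult_mono[OF sawtooth_bounds(3)[of L] sawtooth_bounds(3)[of L]] by (simp add: abs_mult)
  qed measurable
  have "(\<lambda>x. (sawtooth L (x - p + h) - sawtooth L (x - p)) * (sawtooth L (x - q + h) - sawtooth L (x - q)))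
    = (\<lambda>x. sawtooth L (x - (p - h)) * sawtooth L (x - (q - h)) - sawtooth L (x - (p - h)) * sawtooth L (x - q)
        - sawtooth L (x - p) * sawtooth L (x - (q - h)) + sawtooth L (x - p) * sawtooth L (x - q))"
    by (auto simp: algebra_simps)
  then have "(\<integral>x. (sawtooth L (x - p + h) - sawtooth L (x - p)) * (sawtooth L (x - q + h) - sawtooth L (x - q)) \<partial>period_measure L)
    = sawtooth_corr L ((p - h) - (q - h)) + L / 3 - (sawtooth_corr L ((p - h) - q) + L / 3)
      - (sawtooth_corr L (p - (q - h)) + L / 3) + (sawtooth_corr L (p - q) + L / 3)"
    by (simp only: Bochner_Integration.integral_add Bochner_Integration.integral_diff
        Bochner_Integration.integrable_add Bochner_Integration.integrable_diff I sawtooth_product_integral[OF L])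
  then show ?thesis by (simp add: increment_corr_def algebra_simps)
qed

lemma increment_corr_measurable [measurable]:
  assumes [measurable]: "f \<in> borel_measurable M" "g \<in> borel_measurable M"
  shows "(\<lambda>x. increment_corr L (f x) (g x)) \<in> borel_measurable M"
  unfolding increment_corr_def by measurable

text \<open>The interval [-L, 2 L] is what t + h and t - h can reach for t and h in [0, L]. The
  parabola of the base period is continued across it, and the max terms correct its slope beyond the
  kinks at 0 and L.\<close>

lemma sawtooth_corr_eq:
  assumes L: "L > 0" and "- L \<le> y" "y \<le> 2 * L"
  shows "sawtooth_corr L y = y\<^sup>2 / (2 * L) - y / 2 - max 0 (- y) - max 0 (y - L)"
proof -
  consider "y < 0" | "0 \<le> y" "y < L" | "L \<le> y" "y < 2 * L" | "y = 2 * L" using assms by linarith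
  then show ?thesis
  proof cases
    case 1
    then have e: "sawtooth L y = y / L + 1" using sawtooth_eqI[OF L, of "-1" y] assms by simp
    show ?thesis unfolding sawtooth_corr_def e using 1 L by (simp add: field_simps power2_eq_square)
  next
    case 2
    then have e: "sawtooth L y = y / L" using sawtooth_eqI[OF L, of 0 y] assms by simp
    show ?thesis unfolding sawtooth_corr_def e using 2 L by (simp add: field_simps power2_eq_square)
  next
    case 3
    then have e: "sawtooth L y = y / L - 1" using sawtooth_eqI[OF L, of 1 y] assms by simp
    show ?thesis unfolding sawtooth_corr_def e using 3 L by (simp add: field_simps power2_eq_square)
  next
    case 4
    then have e: "sawtooth L y = 0" using sawtooth_eqI[OF L, of 2 y] L by simp
    show ?thesis unfolding sawtooth_corr_def e using 4 L by (simp add: field_simps power2_eq_square)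
  qed
qed

text \<open>The quadratic part has a constant second difference, which gives
  \<open>- h\<^sup>2 / L\<close>; the linear part has none. The max terms record the kink at 0
  passed by t - h and the kink at L passed by t + h.\<close>

lemma increment_corr_eq:
  assumes L: "L > 0" and "0 \<le> h" "h \<le> L" "0 \<le> t" "t \<le> L"
  shows "increment_corr L h t = max 0 (h - t) + max 0 (h - (L - t)) - h\<^sup>2 / L"
proof -
  have "sawtooth_corr L t = t\<^sup>2 / (2 * L) - t / 2"
    using sawtooth_corr_eq[OF L, of t] assms by simp
  moreover have "sawtooth_corr L (t + h) = (t + h)\<^sup>2 / (2 * L) - (t + h) / 2 - max 0 (h - (L - t))"
    using sawtooth_corr_eq[OF L, of "t + h"] assms by (simp add: max_absorb1 add.commute)
  moreover have "sawtooth_corr L (t - h) = (t - h)\<^sup>2 / (2 * L) - (t - h) / 2 - max 0 (h - t)"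
    using sawtooth_corr_eq[OF L, of "t - h"] assms by simp
  ultimately have "increment_corr L h t = max 0 (h - t) + max 0 (h - (L - t))
      + (2 * (t\<^sup>2 / (2 * L)) - (t + h)\<^sup>2 / (2 * L) - (t - h)\<^sup>2 / (2 * L))"
    unfolding increment_corr_def by (simp add: field_simps)
  also have "2 * (t\<^sup>2 / (2 * L)) - (t + h)\<^sup>2 / (2 * L) - (t - h)\<^sup>2 / (2 * L) = - h\<^sup>2 / L"
    using L by (simp add: field_simps power2_eq_square)
  finally show ?thesis by simp
qed

lemma sawtooth_corr_period: "L > 0 \<Longrightarrow> sawtooth_corr L (x + L * of_int k) = sawtooth_corr L x"
  by (simp add: sawtooth_corr_def sawtooth_plus_period)

lemma sawtooth_corr_minus: "sawtooth_corr L (- x) = sawtooth_corr L x"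
  by (cases "x / L \<in> \<int>") (auto simp: sawtooth_corr_def sawtooth_def frac_neg power2_eq_square algebra_simps add_divide_distrib diff_divide_distrib)

lemma increment_corr_period: "L > 0 \<Longrightarrow> increment_corr L h (t + L * of_int k) = increment_corr L h t"
  using sawtooth_corr_period[of L t k] sawtooth_corr_period[of L "t + h" k] sawtooth_corr_period[of L "t - h" k]
  by (simp add: increment_corr_def algebra_simps)

lemma increment_corr_period_step: "L > 0 \<Longrightarrow> increment_corr L (h + L * of_int k) t = increment_corr L h t"
  using sawtooth_corr_period[of L "t + h" k] sawtooth_corr_period[of L "t - h" "-k"]
  by (simp add: increment_corr_def algebra_simps)

lemma increment_corr_minus: "increment_corr L h (- t) = increment_corr L h t"
  using sawtooth_corr_minus[of L t] sawtooth_corr_minus[of L "t + h"] sawtooth_corr_minus[of L "t - h"]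
  by (simp add: increment_corr_def)

lemma increment_corr_minus_step: "increment_corr L (- h) t = increment_corr L h t"
  by (simp add: increment_corr_def)

lemma increment_corr_bound:
  assumes "L > 0" shows "\<bar>increment_corr L h t\<bar> \<le> L"
proof -
  have "0 \<le> - sawtooth_corr L x \<and> - sawtooth_corr L x \<le> L / 8" for x
  proof -
    let ?f = "sawtooth L x"
    have e: "- sawtooth_corr L x = L * (?f * (1 - ?f)) / 2"
      by (simp add: sawtooth_corr_def power2_eq_square right_diff_distrib minus_divide_left)
    have "0 \<le> ?f * (1 - ?f)" using sawtooth_bounds[of L x] by simp
    moreover have "?f * (1 - ?f) \<le> 1 / 4" using zero_le_power2[of "?f - 1/2"] by (simp add: power2_eq_square algebra_simps)
    ultimately show ?thesis using assms unfolding e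
      using mult_left_mono[of "?f * (1 - ?f)" "1/4" L] by simp
  qed
  from this[of t] this[of "t + h"] this[of "t - h"] show ?thesis
    using assms unfolding increment_corr_def by linarith
qed

section \<open>The energy as an integral over the increment\<close>

definition mollifier_measure :: "(real \<Rightarrow> real) \<Rightarrow> real \<Rightarrow> real measure" where
  "mollifier_measure \<rho> \<epsilon> = density lborel (\<lambda>x. ennreal (rescale \<rho> \<epsilon> x))"

lemma sets_mollifier_measure [measurable_cong, simp]: "sets (mollifier_measure \<rho> \<epsilon>) = sets borel"
  by (simp add: mollifier_measure_def)

lemma space_mollifier_measure [simp]: "space (mollifier_measure \<rho> \<epsilon>) = UNIV"
  by (simp add: mollifier_measure_def)

lemma integral_mollifier_measure:
  fixes f :: "real \<Rightarrow> real"
  assumes "mollifier \<rho>" "\<epsilon> > 0" "f \<in> borel_measurable borel"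
  shows "(\<integral>x. f x \<partial>mollifier_measure \<rho> \<epsilon>) = (\<integral>x. rescale \<rho> \<epsilon> x * f x \<partial>lborel)"
  unfolding mollifier_measure_def
  using assms rescale_nonneg[OF assms(1,2)] by (subst integral_density) auto

lemma emeasure_mollifier_measure:
  assumes "mollifier \<rho>" "\<epsilon> > 0"
  shows "emeasure (mollifier_measure \<rho> \<epsilon>) UNIV = 1"
proof -
  have "integrable lborel (rescale \<rho> \<epsilon>)"
    using integral_rescale(1)[OF assms] not_integrable_integral_eq by fastforce
  then show ?thesis
    using assms rescale_nonneg[OF assms]
    by (simp add: mollifier_measure_def emeasure_density nn_integral_eq_integral integral_rescale(1))
qed

lemma finite_mollifier_measure:
  assumes "mollifier \<rho>" "\<epsilon> > 0"
  shows "finite_measure (mollifier_measure \<rho> \<epsilon>)"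
  by (rule finite_measureI) (simp add: emeasure_mollifier_measure[OF assms])

lemma convolve_eq_integral:
  assumes "mollifier \<rho>" "\<epsilon> > 0" and [measurable]: "u \<in> borel_measurable borel"
  shows "convolve (rescale \<rho> \<epsilon>) u x = (\<integral>a. u (x - a) \<partial>mollifier_measure \<rho> \<epsilon>)"
  unfolding convolve_def
  using lborel_integral_real_affine[of "-1" "\<lambda>y. rescale \<rho> \<epsilon> (x - y) * u y" x]
  by (simp add: integral_mollifier_measure[OF assms(1,2)])

text \<open>Kept as a push-forward instead of an explicit density: apart from the change of
  variables, only its total mass, its support, and its mass near 0 from below and above are
  used.\<close>

definition mollifier_diff :: "(real \<Rightarrow> real) \<Rightarrow> real \<Rightarrow> real measure" where
  "mollifier_diff \<rho> \<epsilon> = distr (mollifier_measure \<rho> \<epsilon> \<Otimes>\<^sub>M mollifier_measure \<rho> \<epsilon>) borel (\<lambda>(a, b). a - b)"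

definition config_corr :: "nat \<Rightarrow> (nat \<Rightarrow> real) \<Rightarrow> real \<Rightarrow> real \<Rightarrow> real" where
  "config_corr \<Lambda> X h z = (\<Sum>i\<in>{1..\<Lambda>}. \<Sum>j\<in>{1..\<Lambda>}. increment_corr (real \<Lambda>) h (X i - X j + z))"

lemma config_corr_measurable [measurable]:
  assumes [measurable]: "f \<in> borel_measurable M" "g \<in> borel_measurable M"
  shows "(\<lambda>x. config_corr \<Lambda> X (f x) (g x)) \<in> borel_measurable M"
  unfolding config_corr_def by measurable

text \<open>A square of a mollified increment is an average over two independent samples a and b.
  Fubini moves the integral over x inside this average, where the pair correlations are known in
  closed form.\<close>

lemma increment_integral:
  fixes X :: "nat \<Rightarrow> real"
  assumes m: "mollifier \<rho>" "\<epsilon> > 0" and \<Lambda>: "\<Lambda> \<ge> 1"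
  defines "v \<equiv> convolve (rescale \<rho> \<epsilon>) (sawtooth_sum \<Lambda> X)"
  shows "integrable (period_measure (real \<Lambda>)) (\<lambda>x. (v (x + h) - v x)\<^sup>2)"
    and "(\<integral>x. (v (x + h) - v x)\<^sup>2 \<partial>period_measure (real \<Lambda>)) = (\<integral>z. config_corr \<Lambda> X h z \<partial>mollifier_diff \<rho> \<epsilon>)"
proof -
  define L where "L = real \<Lambda>"
  have L: "L > 0" using \<Lambda> by (simp add: L_def)
  define N where "N = mollifier_measure \<rho> \<epsilon>"
  interpret N: finite_measure N unfolding N_def by (rule finite_mollifier_measure[OF m])
  interpret NN: pair_sigma_finite N N ..
  interpret NN: finite_measure "N \<Otimes>\<^sub>M N" by (rule finite_measure_pair_measure) unfold_locales
  interpret U: finite_measure "period_measure L" by (rule finite_period_measure)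
  interpret UN: pair_sigma_finite "period_measure L" "N \<Otimes>\<^sub>M N" ..
  interpret UN: finite_measure "period_measure L \<Otimes>\<^sub>M (N \<Otimes>\<^sub>M N)"
    by (rule finite_measure_pair_measure) unfold_locales
  have sN[measurable_cong]: "sets N = sets borel" by (simp add: N_def)
  \<comment> \<open>The increment of the unmollified potential; the mollified increment is its
    average over one sample.\<close>
  define G where "G = (\<lambda>y. \<Sum>i\<in>{1..\<Lambda>}. sawtooth L (y - X i + h) - sawtooth L (y - X i))"
  have Gm[measurable]: "G \<in> borel_measurable borel" unfolding G_def by measurable
  have Ge: "G y = sawtooth_sum \<Lambda> X (y + h) - sawtooth_sum \<Lambda> X y" for y
    by (simp add: G_def sawtooth_sum_def sum_subtractf L_def algebra_simps)
  have Gb: "\<bar>G y\<bar> \<le> 2 * L" for y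
    using sawtooth_sum_bound[of \<Lambda> X "y + h"] sawtooth_sum_bound[of \<Lambda> X y] unfolding Ge L_def by linarith
  have GGb: "\<bar>G x * G y\<bar> \<le> 4 * (L * L)" for x y
    using mult_mono[OF Gb[of x] Gb[of y]] L by (simp add: abs_mult)
  have vm[measurable]: "v \<in> borel_measurable borel"
    unfolding v_def convolve_eq_integral[OF m sawtooth_sum_measurable] N_def[symmetric]
    by (rule N.borel_measurable_lebesgue_integral) measurable
  have D: "v (x + h) - v x = (\<integral>a. G (x - a) \<partial>N)" for x
  proof -
    have I: "integrable N (\<lambda>a. sawtooth_sum \<Lambda> X (y - a))" for y
      by (rule N.integrable_const_bound[of _ "real \<Lambda>"]) (auto simp: sawtooth_sum_bound)
    have "v (x + h) - v x = (\<integral>a. sawtooth_sum \<Lambda> X (x + h - a) - sawtooth_sum \<Lambda> X (x - a) \<partial>N)"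
      unfolding v_def convolve_eq_integral[OF m sawtooth_sum_measurable] N_def[symmetric]
      by (rule Bochner_Integration.integral_diff[symmetric]) (rule I)+
    then show ?thesis by (simp add: Ge algebra_simps)
  qed
  have IG: "integrable N (\<lambda>a. G (x - a))" for x
    by (rule N.integrable_const_bound[of _ "2 * L"]) (auto simp: Gb)
  have D2: "(v (x + h) - v x)\<^sup>2 = (\<integral>(a, b). G (x - a) * G (x - b) \<partial>(N \<Otimes>\<^sub>M N))" for x
  proof -
    have "integrable (N \<Otimes>\<^sub>M N) (\<lambda>(a, b). G (x - a) * G (x - b))"
      by (rule NN.integrable_const_bound[of _ "4 * (L * L)"]) (auto simp: split_beta GGb intro!: AE_I2)
    from NN.integral_fst[OF this] show ?thesis
      unfolding D power2_eq_square using IG by (simp add: mult.commute)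
  qed
  have "\<bar>v x\<bar> \<le> real \<Lambda>" for x
  proof -
    have "norm (\<integral>a. sawtooth_sum \<Lambda> X (x - a) \<partial>N) \<le> (\<integral>a. real \<Lambda> \<partial>N)"
      by (rule Bochner_Integration.integral_norm_bound_integral)
        (auto simp: sawtooth_sum_bound intro!: N.integrable_const_bound[of _ "real \<Lambda>"])
    also have "\<dots> = real \<Lambda>" using emeasure_mollifier_measure[OF m]
      by (simp add: measure_def N_def)
    finally show ?thesis unfolding v_def convolve_eq_integral[OF m sawtooth_sum_measurable] N_def[symmetric] by simp
  qed
  note vb = this
  show "integrable (period_measure (real \<Lambda>)) (\<lambda>x. (v (x + h) - v x)\<^sup>2)"
    unfolding L_def[symmetric]
  proof (rule U.integrable_const_bound[of _ "(2 * L)\<^sup>2"])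
    show "AE x in period_measure L. norm ((v (x + h) - v x)\<^sup>2) \<le> (2 * L)\<^sup>2"
    proof (rule AE_I2)
      fix x
      have "\<bar>v (x + h) - v x\<bar> \<le> \<bar>2 * L\<bar>" using vb[of x] vb[of "x + h"] by (simp add: L_def)
      then show "norm ((v (x + h) - v x)\<^sup>2) \<le> (2 * L)\<^sup>2" by (simp add: abs_le_square_iff)
    qed
  qed measurable
  have "(\<integral>x. (v (x + h) - v x)\<^sup>2 \<partial>period_measure (real \<Lambda>))
     = (\<integral>x. (\<integral>p. G (x - fst p) * G (x - snd p) \<partial>(N \<Otimes>\<^sub>M N)) \<partial>period_measure L)"
    unfolding D2 L_def by (simp add: case_prod_unfold)
  also have "\<dots> = (\<integral>p. (\<integral>x. G (x - fst p) * G (x - snd p) \<partial>period_measure L) \<partial>(N \<Otimes>\<^sub>M N))"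
    by (rule UN.Fubini_integral[symmetric], rule UN.integrable_const_bound[of _ "4 * (L * L)"])
       (auto simp: split_beta GGb intro!: AE_I2)
  \<comment> \<open>With the samples a and b fixed, the two copies of the points sit at
    \<open>X i + a\<close> and \<open>X j + b\<close>, so only a - b enters.\<close>
  also have "\<dots> = (\<integral>p. config_corr \<Lambda> X h (fst p - snd p) \<partial>(N \<Otimes>\<^sub>M N))"
  proof (rule Bochner_Integration.integral_cong[OF refl])
    fix p :: "real \<times> real"
    let ?d = "\<lambda>i a x. sawtooth L (x - (X i + a) + h) - sawtooth L (x - (X i + a))"
    have db: "\<bar>?d i a x\<bar> \<le> 1" for i a x
      using sawtooth_bounds[of L "x - (X i + a) + h"] sawtooth_bounds[of L "x - (X i + a)"] by (simp add: abs_le_iff)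
    have I: "integrable (period_measure L) (\<lambda>x. ?d i a x * ?d j b x)" for i j a b
    proof (rule U.integrable_const_bound[of _ 1])
      show "AE x in period_measure L. norm (?d i a x * ?d j b x) \<le> 1"
        using mult_mono[OF db db] by (intro AE_I2) (simp add: abs_mult)
    qed measurable
    have "(\<integral>x. G (x - fst p) * G (x - snd p) \<partial>period_measure L)
      = (\<integral>x. (\<Sum>i\<in>{1..\<Lambda>}. \<Sum>j\<in>{1..\<Lambda>}. ?d i (fst p) x * ?d j (snd p) x) \<partial>period_measure L)"
      unfolding G_def sum_product by (simp add: algebra_simps)
    also have "\<dots> = (\<Sum>i\<in>{1..\<Lambda>}. \<Sum>j\<in>{1..\<Lambda>}. \<integral>x. ?d i (fst p) x * ?d j (snd p) x \<partial>period_measure L)"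
      by (subst Bochner_Integration.integral_sum, intro Bochner_Integration.integrable_sum I)
         (intro sum.cong refl Bochner_Integration.integral_sum I)
    also have "\<dots> = config_corr \<Lambda> X h (fst p - snd p)"
      unfolding increment_corr_integral[OF L] config_corr_def L_def[symmetric] by (simp add: algebra_simps)
    finally show "(\<integral>x. G (x - fst p) * G (x - snd p) \<partial>period_measure L) = config_corr \<Lambda> X h (fst p - snd p)" .
  qed
  also have "\<dots> = (\<integral>z. config_corr \<Lambda> X h z \<partial>mollifier_diff \<rho> \<epsilon>)"
    unfolding mollifier_diff_def N_def[symmetric] by (subst integral_distr) (auto simp: split_beta)
  finally show "(\<integral>x. (v (x + h) - v x)\<^sup>2 \<partial>period_measure (real \<Lambda>)) = (\<integral>z. config_corr \<Lambda> X h z \<partial>mollifier_diff \<rho> \<epsilon>)" .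
qed

lemma convolve_sawtooth_sum_measurable:
  assumes m: "mollifier \<rho>" "\<epsilon> > 0"
  shows "convolve (rescale \<rho> \<epsilon>) (sawtooth_sum \<Lambda> X) \<in> borel_measurable borel"
proof -
  interpret finite_measure "mollifier_measure \<rho> \<epsilon>" by (rule finite_mollifier_measure[OF m])
  show ?thesis
    unfolding convolve_eq_integral[OF m sawtooth_sum_measurable]
    by (rule borel_measurable_lebesgue_integral) measurable
qed

text \<open>By \<open>increment_integral\<close> this is the squared L2 norm over one period of the
  increment with step h of the mollified potential.\<close>

definition mean_corr :: "(real \<Rightarrow> real) \<Rightarrow> real \<Rightarrow> nat \<Rightarrow> (nat \<Rightarrow> real) \<Rightarrow> real \<Rightarrow> real" where
  "mean_corr \<rho> \<epsilon> \<Lambda> X h = (\<integral>z. config_corr \<Lambda> X h z \<partial>mollifier_diff \<rho> \<epsilon>)"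

lemma energy_eq:
  assumes m: "mollifier \<rho>" "\<epsilon> > 0" and \<Lambda>: "\<Lambda> \<ge> 1"
  shows "energy \<rho> s \<epsilon> \<Lambda> X = 1 / 2 * (\<integral>\<^sup>+h. ennreal (mean_corr \<rho> \<epsilon> \<Lambda> X h / \<bar>h\<bar> powr (1 + 2 * s)) \<partial>lborel)"
proof -
  define v where "v = convolve (rescale \<rho> \<epsilon>) (sawtooth_sum \<Lambda> X)"
  define L where "L = real \<Lambda>"
  define w where "w = (\<lambda>h::real. \<bar>h\<bar> powr (1 + 2 * s))"
  have [measurable]: "v \<in> borel_measurable borel"
    unfolding v_def by (rule convolve_sawtooth_sum_measurable[OF m])
  have [measurable]: "w \<in> borel_measurable borel" unfolding w_def by measurable
  have y: "(\<integral>\<^sup>+y. ennreal (\<bar>v x - v y\<bar>\<^sup>2 / w (x - y)) \<partial>lborel) = (\<integral>\<^sup>+h. ennreal ((v (x + h) - v x)\<^sup>2 / w h) \<partial>lborel)" for x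
  proof -
    have "(\<integral>\<^sup>+y. ennreal (\<bar>v x - v y\<bar>\<^sup>2 / w (x - y)) \<partial>lborel)
      = (\<integral>\<^sup>+h. ennreal (\<bar>v x - v (x + h)\<bar>\<^sup>2 / w (x - (x + h))) \<partial>lborel)"
      using nn_integral_real_affine[of "\<lambda>y. ennreal (\<bar>v x - v y\<bar>\<^sup>2 / w (x - y))" 1 x] by simp
    then show ?thesis by (simp add: w_def power2_commute)
  qed
  \<comment> \<open>The energy integrates over a closed interval, \<open>period_measure\<close> over
    a half-open one; the endpoint is a null set.\<close>
  have "(\<integral>\<^sup>+x. (\<integral>\<^sup>+h. ennreal ((v (x + h) - v x)\<^sup>2 / w h) \<partial>lborel) * indicator {0..L} x \<partial>lborel)
    = (\<integral>\<^sup>+x. (\<integral>\<^sup>+h. ennreal ((v (x + h) - v x)\<^sup>2 / w h) \<partial>lborel) * indicator {0..<L} x \<partial>lborel)"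
    by (rule nn_integral_cong_AE)
       (use AE_lborel_singleton[of L] in \<open>eventually_elim, auto simp: indicator_def\<close>)
  also have "\<dots> = (\<integral>\<^sup>+x. (\<integral>\<^sup>+h. ennreal ((v (x + h) - v x)\<^sup>2 / w h) * indicator {0..<L} x \<partial>lborel) \<partial>lborel)"
    by (intro nn_integral_cong nn_integral_multc[symmetric]) measurable
  also have "\<dots> = (\<integral>\<^sup>+h. (\<integral>\<^sup>+x. ennreal ((v (x + h) - v x)\<^sup>2 / w h) * indicator {0..<L} x \<partial>lborel) \<partial>lborel)"
    by (rule lborel_pair.Fubini'[symmetric]) measurable
  also have "\<dots> = (\<integral>\<^sup>+h. ennreal (mean_corr \<rho> \<epsilon> \<Lambda> X h / w h) \<partial>lborel)"
  proof (rule nn_integral_cong)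
    fix h
    have "(\<integral>\<^sup>+x. ennreal ((v (x + h) - v x)\<^sup>2 / w h) * indicator {0..<L} x \<partial>lborel)
      = (\<integral>\<^sup>+x. ennreal ((v (x + h) - v x)\<^sup>2 / w h) \<partial>period_measure L)"
      unfolding period_measure_def by (subst nn_integral_density) (auto simp: mult.commute)
    also have "\<dots> = ennreal (\<integral>x. (v (x + h) - v x)\<^sup>2 / w h \<partial>period_measure L)"
    proof (rule nn_integral_eq_integral)
      show "integrable (period_measure L) (\<lambda>x. (v (x + h) - v x)\<^sup>2 / w h)"
        using increment_integral(1)[OF m \<Lambda>, of X h] unfolding L_def v_def by simp
    qed (auto simp: w_def)
    also have "\<dots> = ennreal (mean_corr \<rho> \<epsilon> \<Lambda> X h / w h)"
      using increment_integral(2)[OF m \<Lambda>, of X h] unfolding L_def v_def mean_corr_def by simp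
    finally show "(\<integral>\<^sup>+x. ennreal ((v (x + h) - v x)\<^sup>2 / w h) * indicator {0..<L} x \<partial>lborel)
      = ennreal (mean_corr \<rho> \<epsilon> \<Lambda> X h / w h)" .
  qed
  finally have "(\<integral>\<^sup>+x. (\<integral>\<^sup>+y. ennreal (\<bar>v x - v y\<bar>\<^sup>2 / w (x - y)) \<partial>lborel) * indicator {0..L} x \<partial>lborel)
    = (\<integral>\<^sup>+h. ennreal (mean_corr \<rho> \<epsilon> \<Lambda> X h / w h) \<partial>lborel)"
    unfolding y .
  then show ?thesis
    unfolding energy_def mollified_potential_difference[OF m \<Lambda>] v_def[symmetric] L_def[symmetric]
      w_def by simp
qed

section \<open>The law of the difference of two independent mollifier samples\<close>

lemma finite_mollifier_diff:
  assumes m: "mollifier \<rho>" "\<epsilon> > 0"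
  shows "finite_measure (mollifier_diff \<rho> \<epsilon>)" "measure (mollifier_diff \<rho> \<epsilon>) UNIV = 1"
proof -
  interpret N: finite_measure "mollifier_measure \<rho> \<epsilon>" by (rule finite_mollifier_measure[OF m])
  have "emeasure (mollifier_diff \<rho> \<epsilon>) UNIV
    = emeasure (mollifier_measure \<rho> \<epsilon> \<Otimes>\<^sub>M mollifier_measure \<rho> \<epsilon>) (UNIV \<times> UNIV)"
    unfolding mollifier_diff_def by (subst emeasure_distr) (auto simp: space_pair_measure)
  also have "\<dots> = 1" by (subst N.emeasure_pair_measure_Times) (auto simp: emeasure_mollifier_measure[OF m])
  finally have e: "emeasure (mollifier_diff \<rho> \<epsilon>) UNIV = 1" .
  then show "measure (mollifier_diff \<rho> \<epsilon>) UNIV = 1" by (simp add: measure_def)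
  show "finite_measure (mollifier_diff \<rho> \<epsilon>)"
    by (rule finite_measureI) (use e in \<open>simp add: mollifier_diff_def\<close>)
qed

lemma sets_mollifier_diff [measurable_cong, simp]: "sets (mollifier_diff \<rho> \<epsilon>) = sets borel"
  by (simp add: mollifier_diff_def)

lemma space_mollifier_diff [simp]: "space (mollifier_diff \<rho> \<epsilon>) = UNIV"
  by (simp add: mollifier_diff_def)

lemma AE_mollifier_diff:
  assumes m: "mollifier \<rho>" "\<epsilon> > 0"
  shows "AE z in mollifier_diff \<rho> \<epsilon>. \<bar>z\<bar> < 2 * \<epsilon>"
proof -
  interpret N: finite_measure "mollifier_measure \<rho> \<epsilon>" by (rule finite_mollifier_measure[OF m])
  interpret NN: pair_sigma_finite "mollifier_measure \<rho> \<epsilon>" "mollifier_measure \<rho> \<epsilon>" ..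
  have "\<bar>x\<bar> < \<epsilon>" if "rescale \<rho> \<epsilon> x > 0" for x
    using rescale_support[OF m, of x] that by linarith
  then have a: "AE x in mollifier_measure \<rho> \<epsilon>. \<bar>x\<bar> < \<epsilon>"
    unfolding mollifier_measure_def using m by (subst AE_density) (auto intro!: AE_I2)
  have "AE p in mollifier_measure \<rho> \<epsilon> \<Otimes>\<^sub>M mollifier_measure \<rho> \<epsilon>. \<bar>fst p - snd p\<bar> < 2 * \<epsilon>"
  proof (rule NN.AE_pair_measure)
    show "AE x in mollifier_measure \<rho> \<epsilon>. AE y in mollifier_measure \<rho> \<epsilon>. \<bar>fst (x, y) - snd (x, y)\<bar> < 2 * \<epsilon>"
      using a
    proof eventually_elim
      case (elim x)
      show ?case using a by eventually_elim (use elim in auto)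
    qed
  qed measurable
  then show ?thesis unfolding mollifier_diff_def by (subst AE_distr_iff) (auto simp: split_beta)
qed

text \<open>Among the countably many cells of length \<eta> that cover the line, one has positive
  mass. With positive probability both samples fall into it, and then they differ by less than
  \<eta>. No knowledge of where \<rho> is positive is required. This makes strictness for z near 0
  visible after averaging.\<close>

lemma mollifier_diff_neighbourhood:
  assumes m: "mollifier \<rho>" "\<epsilon> > 0" and "\<eta> > 0"
  shows "emeasure (mollifier_diff \<rho> \<epsilon>) {-\<eta><..<\<eta>} > 0"
proof -
  let ?N = "mollifier_measure \<rho> \<epsilon>"
  interpret N: finite_measure ?N by (rule finite_mollifier_measure[OF m])
  let ?I = "\<lambda>j::int. {\<eta> * of_int j..<\<eta> * of_int (j + 1)}"
  obtain j where j: "emeasure ?N (?I j) \<noteq> 0"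
  proof (rule ccontr)
    assume "\<not> thesis"
    then have "emeasure ?N (?I j) = 0" for j using that by blast
    then have "(\<Union>j. ?I j) \<in> null_sets ?N" by (intro null_sets_UN') (auto simp: null_sets_def)
    then have "emeasure ?N (\<Union>j. ?I j) = 0" by (rule null_setsD1)
    moreover have "(\<Union>j. ?I j) = UNIV"
    proof -
      have "x \<in> ?I \<lfloor>x / \<eta>\<rfloor>" for x
        using \<open>\<eta> > 0\<close> of_int_floor_le[of "x / \<eta>", THEN mult_left_mono, of \<eta>] floor_correct[of "x / \<eta>"]
        by (auto simp: field_simps)
      then show ?thesis by blast
    qed
    ultimately show False using emeasure_mollifier_measure[OF m] by simp
  qed
  have "0 < emeasure ?N (?I j) * emeasure ?N (?I j)"
    using j by (simp add: ennreal_zero_less_mult_iff zero_less_iff_neq_zero)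
  also have "\<dots> = emeasure (?N \<Otimes>\<^sub>M ?N) (?I j \<times> ?I j)"
    by (rule N.emeasure_pair_measure_Times[symmetric]) auto
  also have "\<dots> \<le> emeasure (?N \<Otimes>\<^sub>M ?N) ((\<lambda>(a, b). a - b) -` {-\<eta><..<\<eta>} \<inter> space (?N \<Otimes>\<^sub>M ?N))"
  proof (rule emeasure_mono)
    show "?I j \<times> ?I j \<subseteq> (\<lambda>(a, b). a - b) -` {-\<eta><..<\<eta>} \<inter> space (?N \<Otimes>\<^sub>M ?N)"
      by (auto simp: space_pair_measure algebra_simps)
    show "(\<lambda>(a, b). a - b) -` {-\<eta><..<\<eta>} \<inter> space (?N \<Otimes>\<^sub>M ?N) \<in> sets (?N \<Otimes>\<^sub>M ?N)"
      by (rule measurable_sets[of _ _ borel]) measurable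
  qed
  also have "\<dots> = emeasure (mollifier_diff \<rho> \<epsilon>) {-\<eta><..<\<eta>}"
    unfolding mollifier_diff_def by (rule emeasure_distr[symmetric]) measurable
  finally show ?thesis .
qed

text \<open>The density of one sample is bounded by some C, so for a fixed first sample the second
  lies within h of it with probability at most 2 C h. The constant depends on \<epsilon>, which is
  harmless: it only serves finiteness of the equispaced energy.\<close>

lemma mollifier_diff_linear_bound:
  assumes m: "mollifier \<rho>" "\<epsilon> > 0"
  obtains B where "B \<ge> 0" "\<And>h. h \<ge> 0 \<Longrightarrow> measure (mollifier_diff \<rho> \<epsilon>) {-h..h} \<le> B * h"
proof -
  let ?N = "mollifier_measure \<rho> \<epsilon>"
  interpret N: finite_measure ?N by (rule finite_mollifier_measure[OF m])
  have "bounded (rescale \<rho> \<epsilon> ` {-\<epsilon>..\<epsilon>})"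
    using rescale_continuous[OF m(1)] by (intro compact_imp_bounded compact_continuous_image) auto
  then obtain C where C: "\<And>x. x \<in> {-\<epsilon>..\<epsilon>} \<Longrightarrow> \<bar>rescale \<rho> \<epsilon> x\<bar> \<le> C"
    unfolding bounded_iff by (metis image_eqI real_norm_def)
  then have C0: "C \<ge> 0" using m(2) order_trans[OF abs_ge_zero C[of 0]] by simp
  have C': "rescale \<rho> \<epsilon> x \<le> C" for x
    using C[of x] rescale_support[OF m, of x] C0 by (cases "\<bar>x\<bar> \<le> \<epsilon>") (auto simp: abs_le_iff)
  have "emeasure (mollifier_diff \<rho> \<epsilon>) {-h..h} \<le> ennreal (2 * C * h)" if "h \<ge> 0" for h
  proof -
    have "emeasure (mollifier_diff \<rho> \<epsilon>) {-h..h} = emeasure (?N \<Otimes>\<^sub>M ?N) ((\<lambda>(a, b). a - b) -` {-h..h} \<inter> space (?N \<Otimes>\<^sub>M ?N))"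
      unfolding mollifier_diff_def by (rule emeasure_distr) measurable
    also have "\<dots> = (\<integral>\<^sup>+a. emeasure ?N (Pair a -` ((\<lambda>(a, b). a - b) -` {-h..h} \<inter> space (?N \<Otimes>\<^sub>M ?N))) \<partial>?N)"
      by (rule N.emeasure_pair_measure_alt) measurable
    also have "\<dots> \<le> (\<integral>\<^sup>+a. ennreal (2 * C * h) \<partial>?N)"
    proof (rule nn_integral_mono)
      fix a :: real
      have "Pair a -` ((\<lambda>(a, b). a - b) -` {-h..h} \<inter> space (?N \<Otimes>\<^sub>M ?N)) = {a-h..a+h}"
        by (auto simp: space_pair_measure)
      moreover have "emeasure ?N {a-h..a+h} \<le> ennreal (2 * C * h)"
      proof -
        have "emeasure ?N {a-h..a+h} = (\<integral>\<^sup>+x. ennreal (rescale \<rho> \<epsilon> x) * indicator {a-h..a+h} x \<partial>lborel)"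
          unfolding mollifier_measure_def using m by (subst emeasure_density) auto
        also have "\<dots> \<le> (\<integral>\<^sup>+x. ennreal C * indicator {a-h..a+h} x \<partial>lborel)"
          by (intro nn_integral_mono mult_right_mono ennreal_leI C') simp
        also have "\<dots> = ennreal C * ennreal (2 * h)"
          using that by (simp add: nn_integral_cmult_indicator)
        also have "\<dots> = ennreal (2 * C * h)" using C0 that by (simp add: ennreal_mult'[symmetric] mult_ac)
        finally show ?thesis .
      qed
      ultimately show "emeasure ?N (Pair a -` ((\<lambda>(a, b). a - b) -` {-h..h} \<inter> space (?N \<Otimes>\<^sub>M ?N))) \<le> ennreal (2 * C * h)"
        by simp
    qed
    also have "\<dots> = ennreal (2 * C * h)" by (simp add: emeasure_mollifier_measure[OF m])
    finally show ?thesis .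
  qed
  then have "measure (mollifier_diff \<rho> \<epsilon>) {-h..h} \<le> 2 * C * h" if "h \<ge> 0" for h
    using that C0 by (auto simp: measure_def intro!: enn2real_leI)
  then show ?thesis using that[of "2 * C"] C0 by simp
qed

section \<open>Cyclic rearrangement and convexity\<close>

lemma sorted_enumeration:
  fixes X :: "nat \<Rightarrow> real"
  obtains \<sigma> where "bij_betw \<sigma> {..<n} {1..n}" "\<And>i j. i \<le> j \<Longrightarrow> j < n \<Longrightarrow> X (\<sigma> i) \<le> X (\<sigma> j)"
proof -
  define l where "l = sort_key X [1..<Suc n]"
  have l: "distinct l" "length l = n" "set l = {1..n}" "sorted (map X l)"
    by (auto simp: l_def)
  show ?thesis
  proof (rule that[of "\<lambda>i. l ! i"])
    show "bij_betw (\<lambda>i. l ! i) {..<n} {1..n}" using bij_betw_nth[OF l(1)] l by blast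
    show "X (l ! i) \<le> X (l ! j)" if "i \<le> j" "j < n" for i j
      using sorted_nth_mono[OF l(4), of i j] that l(2) by simp
  qed
qed

lemma sum_shift_Suc:
  fixes G :: "nat \<Rightarrow> real"
  shows "(\<Sum>i<n. G (Suc i)) = (\<Sum>i<n. G i) + G n - G 0"
  using sum.lessThan_Suc_shift[of G n] by simp

lemma periodic_sum_shift:
  fixes G :: "nat \<Rightarrow> real"
  assumes "\<And>i. G (i + n) = G i"
  shows "(\<Sum>k<n. G (j + k)) = (\<Sum>k<n. G k)"
proof (induction j)
  case (Suc j)
  show ?case using sum_shift_Suc[of "\<lambda>k. G (j + k)" n] assms[of j] Suc by simp
qed simp

text \<open>For a sorted y with values in [0, n) this lists the whole n-periodic point set from
  \<open>y 0\<close> on in increasing order, so that cyclic neighbours become neighbours of a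
  sequence.\<close>

definition unroll :: "nat \<Rightarrow> (nat \<Rightarrow> real) \<Rightarrow> nat \<Rightarrow> real" where
  "unroll n y m = y (m mod n) + real n * real (m div n)"

lemma unroll_period: "n > 0 \<Longrightarrow> unroll n y (m + n) = unroll n y m + real n"
  by (simp add: unroll_def algebra_simps)

lemma unroll_less: "m < n \<Longrightarrow> unroll n y m = y m"
  by (simp add: unroll_def)

text \<open>Row k collects the n pairs of k-th cyclic neighbours. Pairs are grouped this way because
  the sum of the differences in a row does not depend on the configuration.\<close>

definition cyclic_corr :: "nat \<Rightarrow> (nat \<Rightarrow> real) \<Rightarrow> real \<Rightarrow> real \<Rightarrow> real" where
  "cyclic_corr n Y h z = (\<Sum>k<n. \<Sum>i<n. increment_corr (real n) h (Y (i + k) - Y i + z))"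

text \<open>For fixed j the interaction with the m-th unrolled point has period n in m, so the sum
  over a full period may start at j instead of 0.\<close>

lemma sum_pairs_cyclic:
  assumes "n > 0"
  shows "(\<Sum>i<n. \<Sum>j<n. increment_corr (real n) h (y i - y j + z)) = cyclic_corr n (unroll n y) h z"
proof -
  have row: "(\<Sum>i<n. increment_corr (real n) h (y i - y j + z))
     = (\<Sum>k<n. increment_corr (real n) h (unroll n y (j + k) - unroll n y j + z))" if "j < n" for j
  proof -
    let ?G = "\<lambda>m. increment_corr (real n) h (unroll n y m - y j + z)"
    have "?G (m + n) = ?G m" for m
      using increment_corr_period[of "real n" h "unroll n y m - y j + z" 1] assms
      by (simp add: unroll_period algebra_simps)
    from periodic_sum_shift[of ?G n j, OF this] show ?thesis
      using that by (simp add: unroll_less)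
  qed
  have "(\<Sum>i<n. \<Sum>j<n. increment_corr (real n) h (y i - y j + z))
    = (\<Sum>j<n. \<Sum>i<n. increment_corr (real n) h (y i - y j + z))" by (rule sum.swap)
  also have "\<dots> = (\<Sum>j<n. \<Sum>k<n. increment_corr (real n) h (unroll n y (j + k) - unroll n y j + z))"
    using row by simp
  also have "\<dots> = cyclic_corr n (unroll n y) h z" unfolding cyclic_corr_def by (rule sum.swap)
  finally show ?thesis .
qed

lemma config_corr_cyclic:
  assumes "n > 0" "bij_betw \<sigma> {..<n} {1..n}"
  shows "config_corr n X h z = cyclic_corr n (unroll n (\<lambda>i. X (\<sigma> i))) h z"
  unfolding config_corr_def sum_pairs_cyclic[OF assms(1), symmetric]
    sum.reindex_bij_betw[OF assms(2), symmetric] by simp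

lemma unroll_real: "n > 0 \<Longrightarrow> unroll n real = real"
  by (rule ext) (metis unroll_def mod_mult_div_eq of_nat_add of_nat_mult)

text \<open>Only differences of points enter, so the offset \<tau> cancels; and the double sum
  depends only on the set of points, so their labelling does not matter either.\<close>

lemma config_corr_equispaced:
  assumes n: "n > 0" and X: "X \<in> equispaced_configs n"
  shows "config_corr n X h z = cyclic_corr n real h z"
proof -
  obtain \<tau> where inj: "inj_on X {1..n}" and img: "X ` {1..n} = {real j + \<tau> | j. j < n}"
    using X by (auto simp: equispaced_configs_def distinct_configs_def)
  have img': "X ` {1..n} = (\<lambda>j. real j + \<tau>) ` {..<n}" unfolding img by auto
  have r: "(\<Sum>i\<in>{1..n}. g (X i)) = (\<Sum>j<n. g (real j + \<tau>))" for g :: "real \<Rightarrow> real"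
  proof -
    have "(\<Sum>i\<in>{1..n}. g (X i)) = sum g (X ` {1..n})" using inj by (simp add: sum.reindex)
    also have "\<dots> = (\<Sum>j<n. g (real j + \<tau>))" unfolding img' by (subst sum.reindex) (auto simp: inj_on_def)
    finally show ?thesis .
  qed
  have "config_corr n X h z = (\<Sum>i\<in>{1..n}. \<Sum>j<n. increment_corr (real n) h (X i - (real j + \<tau>) + z))"
    unfolding config_corr_def
    by (intro sum.cong refl r[where g = "\<lambda>x. increment_corr (real n) h (X _ - x + z)"])
  also have "\<dots> = (\<Sum>i<n. \<Sum>j<n. increment_corr (real n) h (real i - real j + z))"
    using r[where g = "\<lambda>x. \<Sum>j<n. increment_corr (real n) h (x - (real j + \<tau>) + z)"] by simp
  finally have "config_corr n X h z = (\<Sum>i<n. \<Sum>j<n. increment_corr (real n) h (real i - real j + z))" .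
  then show ?thesis using sum_pairs_cyclic[OF n, of h real z] by (simp add: unroll_real[OF n])
qed

section \<open>Lipschitz bound, minimum and convexity of the pair interaction\<close>

lemma increment_corr_step_reduce:
  assumes "L > 0"
  obtains h' where "0 \<le> h'" "h' \<le> L" "increment_corr L h = increment_corr L h'"
proof -
  obtain k where k: "h = L * sawtooth L h + L * of_int k" using sawtooth_repr[OF assms] .
  show ?thesis
  proof (rule that[of "L * sawtooth L h"])
    show "increment_corr L h = increment_corr L (L * sawtooth L h)"
      using increment_corr_period_step[OF assms, of "L * sawtooth L h" k] k by force
  qed (use sawtooth_bounds[of L h] assms in auto)
qed

lemma increment_corr_shift_reduce:
  assumes "L > 0"
  obtains t' where "0 \<le> t'" "t' \<le> L" "\<And>h. increment_corr L h t = increment_corr L h t'"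
proof -
  obtain k where k: "t = L * sawtooth L t + L * of_int k" using sawtooth_repr[OF assms] .
  show ?thesis
  proof (rule that[of "L * sawtooth L t"])
    show "increment_corr L h t = increment_corr L h (L * sawtooth L t)" for h
      using increment_corr_period[OF assms, of h "L * sawtooth L t" k] k by force
  qed (use sawtooth_bounds[of L t] assms in auto)
qed

text \<open>If d + z leaves [0, L], evenness and periodicity reflect it back at the end it crossed,
  which does not increase the distance to d. On [0, L] one max term has slopes in [-1, 0] and the
  other in [0, 1], so the constant is 1, uniformly in h.\<close>

lemma increment_corr_lipschitz:
  assumes L: "L > 0" and d: "0 \<le> d" "d \<le> L" and z: "\<bar>z\<bar> \<le> L"
  shows "\<bar>increment_corr L h (d + z) - increment_corr L h d\<bar> \<le> \<bar>z\<bar>"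
proof -
  obtain h' where h': "0 \<le> h'" "h' \<le> L" "increment_corr L h = increment_corr L h'"
    by (rule increment_corr_step_reduce[OF L])
  have "\<exists>d'. 0 \<le> d' \<and> d' \<le> L \<and> increment_corr L h' (d + z) = increment_corr L h' d' \<and> \<bar>d' - d\<bar> \<le> \<bar>z\<bar>"
  proof -
    consider "d + z < 0" | "0 \<le> d + z" "d + z \<le> L" | "L < d + z" by linarith
    then show ?thesis
    proof cases
      case 1
      then show ?thesis using d z increment_corr_minus[of L h' "d + z"]
        by (intro exI[of _ "- (d + z)"]) auto
    next
      case 2 then show ?thesis by (intro exI[of _ "d + z"]) auto
    next
      case 3
      have "increment_corr L h' (d + z) = increment_corr L h' (2 * L - (d + z))"
        using increment_corr_minus[of L h' "d + z"] increment_corr_period[OF L, of h' "- (d + z)" 2]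
        by (simp add: algebra_simps)
      with 3 show ?thesis using d z by (intro exI[of _ "2 * L - (d + z)"]) auto
    qed
  qed
  then obtain d' where d': "0 \<le> d'" "d' \<le> L" "increment_corr L h' (d + z) = increment_corr L h' d'" "\<bar>d' - d\<bar> \<le> \<bar>z\<bar>"
    by blast
  have "increment_corr L h' d' - increment_corr L h' d
      = max 0 (h' - d') + max 0 (h' - (L - d')) - (max 0 (h' - d) + max 0 (h' - (L - d)))"
    using increment_corr_eq[OF L h'(1,2)] d d' by simp
  then have "\<bar>increment_corr L h' d' - increment_corr L h' d\<bar> \<le> \<bar>d' - d\<bar>"
    by (auto simp: max_def abs_real_def)
  then show ?thesis using d'(3,4) h'(3) by simp
qed

text \<open>The value left when both max terms vanish. By \<open>increment_corr_far\<close> the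
  equispaced rows k \<ge> 1 attain it for small steps, which is why nothing is lost there.\<close>

lemma increment_corr_ge:
  assumes L: "L > 0" and h: "\<bar>h\<bar> \<le> L"
  shows "- h\<^sup>2 / L \<le> increment_corr L h t"
proof -
  obtain t' where t': "0 \<le> t'" "t' \<le> L" "\<And>h. increment_corr L h t = increment_corr L h t'"
    using increment_corr_shift_reduce[OF L, of t] by metis
  have "increment_corr L h t = increment_corr L \<bar>h\<bar> t'"
    using increment_corr_minus_step[of L h t'] t'(3) by (auto simp: abs_real_def)
  also have "\<dots> = max 0 (\<bar>h\<bar> - t') + max 0 (\<bar>h\<bar> - (L - t')) - h\<^sup>2 / L"
    using increment_corr_eq[OF L _ h t'(1,2)] by simp
  finally show ?thesis by simp
qed

lemma sum_max_ge: "max 0 (\<Sum>i<n. a i) \<le> (\<Sum>i<n. max 0 (a i :: real))"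
  by (intro max.boundedI sum_nonneg sum_mono) auto

text \<open>On [0, L] the interaction is a constant plus two positive parts of affine functions, so
  Jensen reduces to \<open>sum_max_ge\<close>. For strictness: if c \<ge> h, the first positive part
  vanishes at the mean, while any \<open>t i\<close> below h makes it positive.\<close>

lemma increment_corr_jensen:
  assumes L: "L > 0" and n: "n > 0"
    and t: "\<And>i. i < n \<Longrightarrow> 0 \<le> t i \<and> t i \<le> L" and c: "(\<Sum>i<n. t i) = real n * c"
  shows "real n * increment_corr L h c \<le> (\<Sum>i<n. increment_corr L h (t i))"
    and "0 \<le> h \<Longrightarrow> h \<le> c \<Longrightarrow> h \<le> L \<Longrightarrow> i < n \<Longrightarrow> t i < h \<Longrightarrow> real n * increment_corr L h c < (\<Sum>i<n. increment_corr L h (t i))"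
proof -
  have "0 \<le> real n * c" unfolding c[symmetric] by (intro sum_nonneg) (use t in auto)
  then have c0: "0 \<le> c" using n by (simp add: zero_le_mult_iff)
  have "real n * c \<le> (\<Sum>i<n. L)" unfolding c[symmetric] by (intro sum_mono) (use t in auto)
  then have cL: "c \<le> L" using n by simp
  define f where "f = (\<lambda>h t::real. max 0 (h - t))"
  define g where "g = (\<lambda>h t::real. max 0 (h - (L - t)))"
  have eq: "increment_corr L h x = f h x + g h x - h\<^sup>2 / L" if "0 \<le> x" "x \<le> L" "0 \<le> h" "h \<le> L" for h x
    using increment_corr_eq[OF L that(3,4,1,2)] by (simp add: f_def g_def)
  have sumeq: "(\<Sum>i<n. increment_corr L h (t i)) = (\<Sum>i<n. f h (t i)) + (\<Sum>i<n. g h (t i)) - real n * (h\<^sup>2 / L)"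
    if "0 \<le> h" "h \<le> L" for h
  proof -
    have "(\<Sum>i<n. increment_corr L h (t i)) = (\<Sum>i<n. f h (t i) + g h (t i) - h\<^sup>2 / L)"
      using eq t that by (intro sum.cong) auto
    then show ?thesis by (simp add: sum.distrib sum_subtractf)
  qed
  have nmax: "real n * max 0 x = max 0 (real n * x)" for x
    using n by (simp add: max_mult_distrib_left)
  have fj: "real n * f h c \<le> (\<Sum>i<n. f h (t i))" for h
    unfolding f_def nmax using sum_max_ge[of "\<lambda>i. h - t i" n] c by (simp add: sum_subtractf sum.distrib algebra_simps)
  have gj: "real n * g h c \<le> (\<Sum>i<n. g h (t i))" for h
    unfolding g_def nmax using sum_max_ge[of "\<lambda>i. h - (L - t i)" n] c by (simp add: sum_subtractf sum.distrib algebra_simps)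
  obtain h' where h': "0 \<le> h'" "h' \<le> L" "increment_corr L h = increment_corr L h'"
    by (rule increment_corr_step_reduce[OF L])
  show "real n * increment_corr L h c \<le> (\<Sum>i<n. increment_corr L h (t i))"
    unfolding h'(3) sumeq[OF h'(1,2)] eq[OF c0 cL h'(1,2)]
    using fj[of h'] gj[of h'] by (simp add: algebra_simps)
  show "real n * increment_corr L h c < (\<Sum>i<n. increment_corr L h (t i))"
    if h: "0 \<le> h" "h \<le> c" "h \<le> L" "i < n" "t i < h"
  proof -
    have "0 < (\<Sum>i<n. f h (t i))"
      by (rule sum_pos2[of _ i]) (use h in \<open>auto simp: f_def\<close>)
    moreover have "f h c = 0" using h by (simp add: f_def)
    ultimately show ?thesis
      unfolding sumeq[OF h(1,3)] eq[OF c0 cL h(1,3)] using gj[of h] by (simp add: algebra_simps)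
  qed
qed

section \<open>Comparison of a periodic sequence with the integers\<close>

locale periodic_sequence =
  fixes n :: nat and Y :: "nat \<Rightarrow> real"
  assumes n: "n > 0" and mono: "\<And>i j. i \<le> j \<Longrightarrow> Y i \<le> Y j" and period: "\<And>i. Y (i + n) = Y i + real n"
begin

text \<open>Raising k by one moves the window of summation by one index, which by
  \<open>period\<close> adds exactly n.\<close>

lemma sum_differences: "(\<Sum>i<n. Y (i + k) - Y i) = real n * real k"
proof (induction k)
  case (Suc k)
  have "(\<Sum>i<n. Y (i + Suc k)) = (\<Sum>i<n. Y (i + k)) + Y (n + k) - Y k"
    using sum_shift_Suc[of "\<lambda>i. Y (i + k)" n] by simp
  moreover have "Y (n + k) = Y k + real n" using period[of k] by (simp add: add.commute)
  ultimately show ?case using Suc by (simp add: sum_subtractf sum.distrib algebra_simps)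
qed simp

lemma difference_bounds:
  assumes "k \<le> n" shows "0 \<le> Y (i + k) - Y i" "Y (i + k) - Y i \<le> real n"
  using mono[of i "i + k"] mono[of "i + k" "i + n"] period[of i] assms by auto

text \<open>Between \<open>Y i\<close> and its translate \<open>Y (i + n)\<close> there is at least
  one full gap on either side of \<open>Y (i + k)\<close>. A shift by |z| \<le> \<delta> therefore
  keeps the difference in [0, n], where the interaction is convex.\<close>

lemma separated_bounds:
  assumes sep: "\<And>i. \<delta> \<le> Y (Suc i) - Y i" and k: "1 \<le> k" "k < n"
  shows "\<delta> \<le> Y (i + k) - Y i" "Y (i + k) - Y i \<le> real n - \<delta>"
proof -
  show "\<delta> \<le> Y (i + k) - Y i" using sep[of i] mono[of "Suc i" "i + k"] k by simp
  show "Y (i + k) - Y i \<le> real n - \<delta>"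
    using sep[of "i + k"] mono[of "Suc (i + k)" "i + n"] period[of i] k by simp
qed

lemma cyclic_corr_real: "cyclic_corr n real h z = (\<Sum>k<n. real n * increment_corr (real n) h (real k + z))"
  by (simp add: cyclic_corr_def)

lemma row_0: "(\<Sum>i<n. increment_corr (real n) h (Y (i + 0) - Y i + z)) = real n * increment_corr (real n) h (real 0 + z)"
  by simp

text \<open>Jensen in each row with mean k + z. Row 0, where the shifted argument z may be negative,
  is equal on both sides. Strictness is taken from row 1, the row of the gaps, which is a row of the
  sum only for n \<ge> 2.\<close>

lemma separated_le:
  assumes sep: "\<And>i. \<delta> \<le> Y (Suc i) - Y i" and z: "\<bar>z\<bar> \<le> \<delta>"
  shows "cyclic_corr n real h z \<le> cyclic_corr n Y h z"
    and "0 \<le> h \<Longrightarrow> h \<le> 1 \<Longrightarrow> h \<le> 1 + z \<Longrightarrow> n \<ge> 2 \<Longrightarrow> j < n \<Longrightarrow> Y (Suc j) - Y j + z < h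
      \<Longrightarrow> cyclic_corr n real h z < cyclic_corr n Y h z"
proof -
  let ?t = "\<lambda>k i. Y (i + k) - Y i + z"
  have b: "0 \<le> ?t k i \<and> ?t k i \<le> real n" if "1 \<le> k" "k < n" for k i
    using separated_bounds[OF sep that, of i] z by auto
  have s: "(\<Sum>i<n. ?t k i) = real n * (real k + z)" for k
    using sum_differences[of k] by (simp only: sum.distrib) (simp add: algebra_simps)
  have n0: "real n > 0" using n by simp
  have row: "real n * increment_corr (real n) h (real k + z) \<le> (\<Sum>i<n. increment_corr (real n) h (?t k i))" if "k < n" for k
  proof (cases "k = 0")
    case False
    then show ?thesis using b that s by (intro increment_corr_jensen(1)[OF n0 n]) auto
  qed (use row_0 in simp)
  show "cyclic_corr n real h z \<le> cyclic_corr n Y h z"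
    unfolding cyclic_corr_real unfolding cyclic_corr_def by (intro sum_mono row) auto
  show "cyclic_corr n real h z < cyclic_corr n Y h z"
    if h: "0 \<le> h" "h \<le> 1" "h \<le> 1 + z" "n \<ge> 2" "j < n" "Y (Suc j) - Y j + z < h"
  proof -
    have "real n * increment_corr (real n) h (real 1 + z) < (\<Sum>i<n. increment_corr (real n) h (?t 1 i))"
      by (rule increment_corr_jensen(2)[OF n0 n _ s, of _ h j]) (use b[of 1] h in auto)
    note strict = this
    show ?thesis unfolding cyclic_corr_real unfolding cyclic_corr_def
    proof (rule sum_strict_mono_ex1)
      show "\<exists>k\<in>{..<n}. real n * increment_corr (real n) h (real k + z)
          < (\<Sum>i<n. increment_corr (real n) h (?t k i))"
        using strict \<open>n \<ge> 2\<close> by (intro bexI[of _ 1]) auto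
    qed (use row in auto)
  qed
qed

text \<open>Without separation Jensen is applied at z = 0, where all differences lie in [0, n].
  Removing z on one side and restoring it on the other costs \<delta> per pair each time, hence 2
  \<delta> for each of the \<open>n\<^sup>2\<close> pairs.\<close>

lemma cyclic_corr_lower:
  assumes z: "\<bar>z\<bar> \<le> \<delta>" "\<delta> \<le> 1"
  shows "cyclic_corr n real h z - 2 * (real n)\<^sup>2 * \<delta> \<le> cyclic_corr n Y h z"
proof -
  have n0: "real n > 0" using n by simp
  have zn: "\<bar>z\<bar> \<le> real n" using z n by linarith
  have row: "real n * increment_corr (real n) h (real k + z) - real n * (2 * \<delta>)
      \<le> (\<Sum>i<n. increment_corr (real n) h (Y (i + k) - Y i + z))" if "k < n" for k
  proof -
    have "real n * increment_corr (real n) h (real k + z) \<le> real n * (increment_corr (real n) h (real k) + \<delta>)"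
      using increment_corr_lipschitz[OF n0 _ _ zn, of "real k" h] that z(1) by (intro mult_left_mono) auto
    moreover have "real n * increment_corr (real n) h (real k) \<le> (\<Sum>i<n. increment_corr (real n) h (Y (i + k) - Y i))"
      using difference_bounds[of k] that sum_differences[of k] by (intro increment_corr_jensen(1)[OF n0 n]) auto
    moreover have "(\<Sum>i<n. increment_corr (real n) h (Y (i + k) - Y i) - \<delta>)
        \<le> (\<Sum>i<n. increment_corr (real n) h (Y (i + k) - Y i + z))"
    proof (rule sum_mono)
      fix i
      show "increment_corr (real n) h (Y (i + k) - Y i) - \<delta> \<le> increment_corr (real n) h (Y (i + k) - Y i + z)"
        using increment_corr_lipschitz[OF n0 difference_bounds[of k i] zn, of h] that z(1) by auto
    qed
    ultimately show ?thesis by (simp add: sum_subtractf algebra_simps)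
  qed
  have "(\<Sum>k<n. real n * increment_corr (real n) h (real k + z) - real n * (2 * \<delta>)) \<le> cyclic_corr n Y h z"
    unfolding cyclic_corr_def by (intro sum_mono row) auto
  then show ?thesis
    unfolding cyclic_corr_real by (simp add: sum_subtractf power2_eq_square algebra_simps)
qed

end

text \<open>The point k + z keeps distance at least 1/2 from 0 and from n, and |h| is at most 1/2,
  so both max terms vanish.\<close>

lemma increment_corr_far:
  assumes "1 \<le> k" "k < n" "\<bar>z\<bar> \<le> 1/2" "\<bar>h\<bar> \<le> 1/2"
  shows "increment_corr (real n) h (real k + z) = - h\<^sup>2 / real n"
proof -
  have k: "1 \<le> real k" "real k + 1 \<le> real n" using assms by linarith+
  have "increment_corr (real n) h (real k + z) = increment_corr (real n) \<bar>h\<bar> (real k + z)"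
    using increment_corr_minus_step[of "real n" h] by (auto simp: abs_real_def)
  also have "\<dots> = max 0 (\<bar>h\<bar> - (real k + z)) + max 0 (\<bar>h\<bar> - (real n - (real k + z))) - h\<^sup>2 / real n"
    by (subst increment_corr_eq) (use k assms in auto)
  also have "\<dots> = - h\<^sup>2 / real n" using k assms by (auto simp: max_def abs_real_def)
  finally show ?thesis .
qed

context periodic_sequence begin

text \<open>Here the comparison holds entry by entry, not only for row sums, as the equispaced
  entries with k \<ge> 1 are minimal. A short gap raises its own entry in row 1 above the minimum by
  at least h minus the gap, up to |z| by the Lipschitz bound.\<close>

lemma small_step_le:
  assumes z: "\<bar>z\<bar> \<le> 1/2" and h: "\<bar>h\<bar> \<le> 1/2"
  shows "cyclic_corr n real h z \<le> cyclic_corr n Y h z"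
    and "j < n \<Longrightarrow> n \<ge> 2 \<Longrightarrow> 0 \<le> h \<Longrightarrow> cyclic_corr n real h z + (h - (Y (Suc j) - Y j) - \<bar>z\<bar>) \<le> cyclic_corr n Y h z"
proof -
  have n0: "real n > 0" using n by simp
  have hn: "\<bar>h\<bar> \<le> real n" "\<bar>z\<bar> \<le> real n" using h z n by linarith+
  let ?A = "increment_corr (real n) h"
  have entry: "?A (real k + z) \<le> ?A (Y (i + k) - Y i + z)" if "k < n" for k i
  proof (cases "k = 0")
    case False
    then show ?thesis using increment_corr_far[of k n z h] increment_corr_ge[OF n0 hn(1)] that z h by simp
  qed simp
  have row: "real n * ?A (real k + z) \<le> (\<Sum>i<n. ?A (Y (i + k) - Y i + z))" if "k < n" for k
    using sum_mono[of "{..<n}" "\<lambda>_. ?A (real k + z)" "\<lambda>i. ?A (Y (i + k) - Y i + z)"] entry[OF that] by simp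
  show "cyclic_corr n real h z \<le> cyclic_corr n Y h z"
    unfolding cyclic_corr_real unfolding cyclic_corr_def by (intro sum_mono row) auto
  assume j: "j < n" and n2: "n \<ge> 2" and h0: "0 \<le> h"
  let ?g = "h - (Y (Suc j) - Y j) - \<bar>z\<bar>"
  have d: "0 \<le> Y (Suc j) - Y j" "Y (Suc j) - Y j \<le> real n"
    using difference_bounds[of 1 j] n by auto
  have "?A (Y (j + 1) - Y j) \<ge> h - (Y (Suc j) - Y j) - h\<^sup>2 / real n"
    using increment_corr_eq[OF n0 h0 _ d] hn by simp
  then have g: "?A (real 1 + z) + ?g \<le> ?A (Y (j + 1) - Y j + z)"
    using increment_corr_lipschitz[OF n0 d hn(2), of h] increment_corr_far[of 1 n z h] n2 z h by auto
  have "(\<Sum>i<n. ?A (real 1 + z) + (if i = j then ?g else 0)) \<le> (\<Sum>i<n. ?A (Y (i + 1) - Y i + z))"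
    by (rule sum_mono) (use g entry[of 1] n2 in auto)
  then have row1: "real n * ?A (real 1 + z) + ?g \<le> (\<Sum>i<n. ?A (Y (i + 1) - Y i + z))"
    using j by (simp add: sum.distrib)
  have "(\<Sum>k<n. real n * ?A (real k + z) + (if k = 1 then ?g else 0)) \<le> cyclic_corr n Y h z"
    unfolding cyclic_corr_def by (rule sum_mono) (use row1 row in auto)
  then show "cyclic_corr n real h z + ?g \<le> cyclic_corr n Y h z"
    unfolding cyclic_corr_real using n2 by (simp add: sum.distrib)
qed

end

text \<open>The values lie in [0, n), so the sorted list continues monotonically across the period
  boundary. If all gaps are 1, the points are i + c with c = \<open>y 0\<close>; the last one is
  below n, which forces c < 1.\<close>

lemma config_unroll:
  assumes n: "n > 0" and X: "X \<in> configs n"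
  obtains Y where "periodic_sequence n Y" "\<And>h z. config_corr n X h z = cyclic_corr n Y h z"
    "(\<And>i. i < n \<Longrightarrow> Y (Suc i) - Y i = 1) \<Longrightarrow> X \<in> equispaced_configs n"
proof -
  obtain \<sigma> where \<sigma>: "bij_betw \<sigma> {..<n} {1..n}" "\<And>i j. i \<le> j \<Longrightarrow> j < n \<Longrightarrow> X (\<sigma> i) \<le> X (\<sigma> j)"
    using sorted_enumeration[of n X] by metis
  define y where "y = (\<lambda>i. X (\<sigma> i))"
  have y: "0 \<le> y i" "y i < real n" if "i < n" for i
  proof -
    have "\<sigma> i \<in> {1..n}" using \<sigma>(1) that by (auto simp: bij_betw_def)
    then show "0 \<le> y i" "y i < real n" using X by (auto simp: configs_def y_def PiE_iff)
  qed
  have step: "unroll n y m \<le> unroll n y (Suc m)" for m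
  proof (cases "Suc (m mod n) = n")
    case True
    then have "y (m mod n) \<le> real n + y 0" using y[of "m mod n"] y[of 0] n by simp
    then show ?thesis using True by (simp add: unroll_def mod_Suc div_Suc algebra_simps)
  next
    case False
    then have "Suc (m mod n) < n" using mod_less_divisor[OF n, of m] by linarith
    then have "y (m mod n) \<le> y (Suc (m mod n))" unfolding y_def by (intro \<sigma>(2)) auto
    then show ?thesis using False by (simp add: unroll_def mod_Suc div_Suc)
  qed
  show ?thesis
  proof (rule that[of "unroll n y"])
    show "periodic_sequence n (unroll n y)"
    proof
      show "unroll n y i \<le> unroll n y j" if "i \<le> j" for i j
        using lift_Suc_mono_le[of "unroll n y", OF step that] .
    qed (use n unroll_period in auto)
    show "config_corr n X h z = cyclic_corr n (unroll n y) h z" for h z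
      unfolding y_def by (rule config_corr_cyclic[OF n \<sigma>(1)])
    assume gaps: "\<And>i. i < n \<Longrightarrow> unroll n y (Suc i) - unroll n y i = 1"
    define c where "c = y 0"
    have yi: "y i = real i + c" if "i < n" for i
      using that
    proof (induction i)
      case (Suc i)
      then show ?case using gaps[of i] by (simp add: unroll_less)
    qed (simp add: c_def)
    have "y (n - 1) < real n" using y[of "n - 1"] n by simp
    then have \<tau>: "0 \<le> c" "c < 1" using yi[of "n - 1"] y[of 0] n by (auto simp: of_nat_diff c_def)
    have img: "X ` {1..n} = y ` {..<n}"
      using \<sigma>(1) unfolding y_def bij_betw_def by (metis image_image)
    have "inj_on y {..<n}" by (rule inj_onI) (use yi in auto)
    \<comment> \<open>The image has n elements, so X itself must be injective.\<close>
    then have "card (X ` {1..n}) = n" unfolding img by (simp add: card_image)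
    then have "inj_on X {1..n}" by (intro eq_card_imp_inj_on) auto
    moreover have "X ` {1..n} = {real j + c | j. j < n}" unfolding img using yi by force
    ultimately show "X \<in> equispaced_configs n"
      using X \<tau> by (auto simp: equispaced_configs_def distinct_configs_def)
  qed
qed

section \<open>Comparison of energies\<close>

lemma powr_tail_finite:
  fixes s :: real
  assumes "s > 0" "a > 0"
  shows "(\<integral>\<^sup>+h. ennreal (1 / \<bar>h\<bar> powr (1 + 2 * s)) * indicator {h. a \<le> \<bar>h\<bar>} h \<partial>lborel) < \<infinity>"
proof -
  let ?f = "\<lambda>h::real. ennreal (h powr (- (1 + 2 * s))) * indicator {a..} h"
  have e: "1 / \<bar>h\<bar> powr (1 + 2 * s) = \<bar>h\<bar> powr (- (1 + 2 * s))" for h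
    by (rule powr_minus_divide[symmetric])
  have "(\<integral>\<^sup>+h. ?f h \<partial>lborel) = ennreal (- (a powr (- (1 + 2 * s) + 1)) / (- (1 + 2 * s) + 1))"
    using has_integral_powr_to_inf[of "- (1 + 2 * s)" a] assms
    by (intro nn_integral_has_integral_lebesgue') auto
  then have fin: "(\<integral>\<^sup>+h. ?f h \<partial>lborel) < \<infinity>" by simp
  have "(\<integral>\<^sup>+h. ennreal (1 / \<bar>h\<bar> powr (1 + 2 * s)) * indicator {h. a \<le> \<bar>h\<bar>} h \<partial>lborel)
     = (\<integral>\<^sup>+h. ?f h + ?f (- h) \<partial>lborel)"
    unfolding e using assms by (intro nn_integral_cong) (auto simp: indicator_def abs_real_def)
  also have "\<dots> = (\<integral>\<^sup>+h. ?f h \<partial>lborel) + (\<integral>\<^sup>+h. ?f (- h) \<partial>lborel)"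
    by (rule nn_integral_add) measurable
  also have "(\<integral>\<^sup>+h. ?f (- h) \<partial>lborel) = (\<integral>\<^sup>+h. ?f h \<partial>lborel)"
    using nn_integral_real_affine[of ?f "-1" 0] by simp
  finally show ?thesis using fin by simp
qed

text \<open>The exponent 2 - (1 + 2 s) = 1 - 2 s exceeds -1 because s < 1; a correlation that is
  O(\<open>h\<^sup>2\<close>) is thus integrable against the weight at 0.\<close>

lemma powr_origin_finite:
  fixes s :: real
  assumes "s < 1" "a > 0"
  shows "(\<integral>\<^sup>+h. ennreal (h\<^sup>2 / \<bar>h\<bar> powr (1 + 2 * s)) * indicator {h. \<bar>h\<bar> \<le> a} h \<partial>lborel) < \<infinity>"
proof -
  let ?f = "\<lambda>h::real. ennreal (h powr (1 - 2 * s)) * indicator {0..a} h"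
  have e: "h\<^sup>2 / \<bar>h\<bar> powr (1 + 2 * s) = \<bar>h\<bar> powr (1 - 2 * s)" if "h \<noteq> 0" for h :: real
  proof -
    have "h\<^sup>2 = \<bar>h\<bar> powr 2" using that by (simp add: powr_numeral)
    then have "h\<^sup>2 / \<bar>h\<bar> powr (1 + 2 * s) = \<bar>h\<bar> powr (2 - (1 + 2 * s))" by (simp only: powr_diff)
    then show ?thesis by (simp add: algebra_simps)
  qed
  have "(\<integral>\<^sup>+h. ?f h \<partial>lborel) = ennreal (a powr (1 - 2 * s + 1) / (1 - 2 * s + 1))"
    using has_integral_powr_from_0[of "1 - 2 * s" a] assms
    by (intro nn_integral_has_integral_lebesgue') auto
  then have fin: "(\<integral>\<^sup>+h. ?f h \<partial>lborel) < \<infinity>" by simp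
  have "(\<integral>\<^sup>+h. ennreal (h\<^sup>2 / \<bar>h\<bar> powr (1 + 2 * s)) * indicator {h. \<bar>h\<bar> \<le> a} h \<partial>lborel)
     \<le> (\<integral>\<^sup>+h. ?f h + ?f (- h) \<partial>lborel)"
  proof (rule nn_integral_mono)
    fix h :: real
    show "ennreal (h\<^sup>2 / \<bar>h\<bar> powr (1 + 2 * s)) * indicator {h. \<bar>h\<bar> \<le> a} h \<le> ?f h + ?f (- h)"
      using e[of h] by (cases "h = 0") (auto simp: indicator_def abs_real_def)
  qed
  also have "\<dots> = (\<integral>\<^sup>+h. ?f h \<partial>lborel) + (\<integral>\<^sup>+h. ?f (- h) \<partial>lborel)"
    by (rule nn_integral_add) measurable
  also have "(\<integral>\<^sup>+h. ?f (- h) \<partial>lborel) = (\<integral>\<^sup>+h. ?f h \<partial>lborel)"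
    using nn_integral_real_affine[of ?f "-1" 0] by simp
  finally show ?thesis using fin by (simp add: order_le_less_trans)
qed

section \<open>Averaged correlations and comparison of integrals for a fixed mollifier and
  scale\<close>

context
  fixes \<rho> :: "real \<Rightarrow> real" and \<epsilon> :: real and n :: nat
  assumes m: "mollifier \<rho>" and \<epsilon>: "\<epsilon> > 0" and n: "n \<ge> 1"
begin

interpretation finite_measure "mollifier_diff \<rho> \<epsilon>" by (rule finite_mollifier_diff[OF m \<epsilon>])

lemma integrable_config_corr: "integrable (mollifier_diff \<rho> \<epsilon>) (config_corr n X h)"
  and config_corr_bound: "\<bar>config_corr n X h z\<bar> \<le> real n ^ 3"
proof -
  show b: "\<bar>config_corr n X h z\<bar> \<le> real n ^ 3" for z
  proof -
    have "\<bar>config_corr n X h z\<bar> \<le> (\<Sum>i\<in>{1..n}. \<Sum>j\<in>{1..n}. real n)"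
      unfolding config_corr_def
      by (intro order_trans[OF sum_abs] sum_mono increment_corr_bound) (use n in auto)
    then show ?thesis by (simp add: power3_eq_cube)
  qed
  show "integrable (mollifier_diff \<rho> \<epsilon>) (config_corr n X h)"
    by (rule integrable_const_bound[of _ "real n ^ 3"]) (use b in auto)
qed

lemma mean_corr_measurable [measurable]: "mean_corr \<rho> \<epsilon> n X \<in> borel_measurable borel"
  unfolding mean_corr_def[abs_def] by (rule borel_measurable_lebesgue_integral) measurable

text \<open>Not visible from \<open>config_corr\<close>, whose entries can be negative; it comes
  from the representation as the integral of a square.\<close>

lemma mean_corr_nonneg: "mean_corr \<rho> \<epsilon> n X h \<ge> 0"
  unfolding mean_corr_def increment_integral(2)[OF m \<epsilon> n, symmetric] by simp

lemma mean_corr_mono: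
  assumes "\<And>z. \<bar>z\<bar> < 2 * \<epsilon> \<Longrightarrow> config_corr n X h z + c \<le> config_corr n X' h z"
  shows "mean_corr \<rho> \<epsilon> n X h + c \<le> mean_corr \<rho> \<epsilon> n X' h"
proof -
  have "(\<integral>z. config_corr n X h z + c \<partial>mollifier_diff \<rho> \<epsilon>) \<le> (\<integral>z. config_corr n X' h z \<partial>mollifier_diff \<rho> \<epsilon>)"
  proof (rule integral_mono_AE)
    show "AE z in mollifier_diff \<rho> \<epsilon>. config_corr n X h z + c \<le> config_corr n X' h z"
      using AE_mollifier_diff[OF m \<epsilon>] by eventually_elim (rule assms)
  qed (auto intro: integrable_config_corr)
  then show ?thesis
    unfolding mean_corr_def using integrable_config_corr finite_mollifier_diff(2)[OF m \<epsilon>] by simp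
qed

lemma mean_corr_strict:
  assumes le: "\<And>z. \<bar>z\<bar> < 2 * \<epsilon> \<Longrightarrow> config_corr n X h z \<le> config_corr n X' h z"
    and "\<eta> > 0" and less: "\<And>z. \<bar>z\<bar> < \<eta> \<Longrightarrow> \<bar>z\<bar> < 2 * \<epsilon> \<Longrightarrow> config_corr n X h z < config_corr n X' h z"
  shows "mean_corr \<rho> \<epsilon> n X h < mean_corr \<rho> \<epsilon> n X' h"
  unfolding mean_corr_def
proof (rule integral_less_AE[where A = "{-\<eta><..<\<eta>}"])
  show "emeasure (mollifier_diff \<rho> \<epsilon>) {-\<eta><..<\<eta>} \<noteq> 0"
    using mollifier_diff_neighbourhood[OF m \<epsilon> \<open>\<eta> > 0\<close>] by simp
  show "AE z in mollifier_diff \<rho> \<epsilon>. z \<in> {-\<eta><..<\<eta>} \<longrightarrow> config_corr n X h z \<noteq> config_corr n X' h z"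
    using AE_mollifier_diff[OF m \<epsilon>]
  proof eventually_elim
    case (elim z)
    then show ?case using less[of z] by (auto simp: abs_less_iff)
  qed
  show "AE z in mollifier_diff \<rho> \<epsilon>. config_corr n X h z \<le> config_corr n X' h z"
    using AE_mollifier_diff[OF m \<epsilon>] by eventually_elim (rule le)
qed (auto intro: integrable_config_corr)

text \<open>For small h the rows k \<ge> 1 are not positive, so only the self-interaction counts. It
  is at most |h| per point and positive only for |z| \<le> |h|, an event of probability at most B
  |h|; the product gives the quadratic order.\<close>

lemma mean_corr_equispaced_small:
  assumes C: "C \<in> equispaced_configs n" and \<epsilon>4: "\<epsilon> \<le> 1 / 4"
    and B: "\<And>h. h \<ge> 0 \<Longrightarrow> measure (mollifier_diff \<rho> \<epsilon>) {-h..h} \<le> B * h" and h: "\<bar>h\<bar> \<le> 1 / 2"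
  shows "mean_corr \<rho> \<epsilon> n C h \<le> real n * B * h\<^sup>2"
proof -
  have n0: "real n > 0" "n > 0" using n by auto
  have "config_corr n C h z \<le> real n * \<bar>h\<bar> * indicator {-\<bar>h\<bar>..\<bar>h\<bar>} z" if z: "\<bar>z\<bar> < 2 * \<epsilon>" for z
  proof -
    have z2: "\<bar>z\<bar> \<le> 1/2" using z \<epsilon>4 by simp
    have "increment_corr (real n) h z = increment_corr (real n) \<bar>h\<bar> \<bar>z\<bar>"
      using increment_corr_minus_step[of "real n" h] increment_corr_minus[of "real n" _ z]
      by (auto simp: abs_real_def)
    also have "\<dots> = max 0 (\<bar>h\<bar> - \<bar>z\<bar>) + max 0 (\<bar>h\<bar> - (real n - \<bar>z\<bar>)) - h\<^sup>2 / real n"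
      by (subst increment_corr_eq) (use z2 h n in auto)
    also have "\<dots> \<le> \<bar>h\<bar> * indicator {-\<bar>h\<bar>..\<bar>h\<bar>} z"
    proof -
      have "max 0 (\<bar>h\<bar> - (real n - \<bar>z\<bar>)) = 0" using z2 h n by (intro max_absorb1) linarith
      moreover have "0 \<le> h\<^sup>2 / real n" by simp
      moreover have "max 0 (\<bar>h\<bar> - \<bar>z\<bar>) \<le> \<bar>h\<bar> * indicator {-\<bar>h\<bar>..\<bar>h\<bar>} z"
        by (cases "\<bar>z\<bar> \<le> \<bar>h\<bar>") (auto simp: indicator_def)
      ultimately show ?thesis by linarith
    qed
    finally have k0: "increment_corr (real n) h z \<le> \<bar>h\<bar> * indicator {-\<bar>h\<bar>..\<bar>h\<bar>} z" .
    have "config_corr n C h z = (\<Sum>k<n. real n * increment_corr (real n) h (real k + z))"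
      unfolding config_corr_equispaced[OF n0(2) C] cyclic_corr_def by simp
    also have "\<dots> \<le> (\<Sum>k<n. if k = 0 then real n * (\<bar>h\<bar> * indicator {-\<bar>h\<bar>..\<bar>h\<bar>} z) else 0)"
    proof (rule sum_mono)
      fix k assume "k \<in> {..<n}"
      then show "real n * increment_corr (real n) h (real k + z)
          \<le> (if k = 0 then real n * (\<bar>h\<bar> * indicator {-\<bar>h\<bar>..\<bar>h\<bar>} z) else 0)"
        using mult_left_mono[OF k0, of "real n"] increment_corr_far[of k n z h] z2 h n by auto
    qed
    also have "\<dots> = real n * \<bar>h\<bar> * indicator {-\<bar>h\<bar>..\<bar>h\<bar>} z" using n by simp
    finally show ?thesis .
  qed
  then have "mean_corr \<rho> \<epsilon> n C h \<le> (\<integral>z. real n * \<bar>h\<bar> * indicator {-\<bar>h\<bar>..\<bar>h\<bar>} z \<partial>mollifier_diff \<rho> \<epsilon>)"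
    unfolding mean_corr_def
  proof (intro integral_mono_AE)
    show "AE z in mollifier_diff \<rho> \<epsilon>. config_corr n C h z \<le> real n * \<bar>h\<bar> * indicator {-\<bar>h\<bar>..\<bar>h\<bar>} z"
      if "\<And>z. \<bar>z\<bar> < 2 * \<epsilon> \<Longrightarrow> config_corr n C h z \<le> real n * \<bar>h\<bar> * indicator {-\<bar>h\<bar>..\<bar>h\<bar>} z"
      using AE_mollifier_diff[OF m \<epsilon>] by eventually_elim (rule that)
    show "integrable (mollifier_diff \<rho> \<epsilon>) (\<lambda>z. real n * \<bar>h\<bar> * indicator {-\<bar>h\<bar>..\<bar>h\<bar>} z)"
      by (rule integrable_const_bound[of _ "real n * \<bar>h\<bar>"]) (auto simp: indicator_def)
  qed (rule integrable_config_corr)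
  also have "\<dots> = real n * \<bar>h\<bar> * measure (mollifier_diff \<rho> \<epsilon>) {-\<bar>h\<bar>..\<bar>h\<bar>}" by simp
  also have "\<dots> \<le> real n * \<bar>h\<bar> * (B * \<bar>h\<bar>)" by (intro mult_left_mono B) auto
  finally show ?thesis by (simp add: power2_eq_square mult_ac)
qed

text \<open>Quadratic bound for |h| \<le> 1/2, crude bound beyond. Finiteness is required only on
  the side that is to be the smaller one, so nothing similar is proved for other
  configurations.\<close>

lemma equispaced_integral_finite:
  assumes C: "C \<in> equispaced_configs n" and \<epsilon>4: "\<epsilon> \<le> 1 / 4" and s: "0 < s" "s < 1"
  shows "(\<integral>\<^sup>+h. ennreal (mean_corr \<rho> \<epsilon> n C h / \<bar>h\<bar> powr (1 + 2 * s)) \<partial>lborel) < \<infinity>"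
proof -
  obtain B where B: "B \<ge> 0" "\<And>h. h \<ge> 0 \<Longrightarrow> measure (mollifier_diff \<rho> \<epsilon>) {-h..h} \<le> B * h"
    using mollifier_diff_linear_bound[OF m \<epsilon>] by metis
  let ?w = "\<lambda>h::real. \<bar>h\<bar> powr (1 + 2 * s)"
  let ?a = "\<lambda>h. ennreal (h\<^sup>2 / ?w h) * indicator {h. \<bar>h\<bar> \<le> 1/2} h"
  let ?b = "\<lambda>h. ennreal (1 / ?w h) * indicator {h. 1/2 \<le> \<bar>h\<bar>} h"
  have "ennreal (mean_corr \<rho> \<epsilon> n C h / ?w h) \<le> ennreal (real n * B) * ?a h + ennreal (real n ^ 3) * ?b h" for h
  proof (cases "\<bar>h\<bar> \<le> 1/2")
    case True
    have "ennreal (mean_corr \<rho> \<epsilon> n C h / ?w h) \<le> ennreal (real n * B * (h\<^sup>2 / ?w h))"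
      using divide_right_mono[OF mean_corr_equispaced_small[OF C \<epsilon>4 B(2) True], of "?w h"]
      by (intro ennreal_leI) simp
    also have "\<dots> = ennreal (real n * B) * ?a h" using True B(1) by (subst ennreal_mult) auto
    finally show ?thesis by (rule order_trans) (simp add: add_increasing2)
  next
    case False
    have "mean_corr \<rho> \<epsilon> n C h \<le> (\<integral>z. real n ^ 3 \<partial>mollifier_diff \<rho> \<epsilon>)"
      unfolding mean_corr_def using config_corr_bound[of C h]
      by (intro integral_mono integrable_config_corr) (auto simp: abs_le_iff)
    then have "mean_corr \<rho> \<epsilon> n C h \<le> real n ^ 3" using finite_mollifier_diff(2)[OF m \<epsilon>] by simp
    then have "ennreal (mean_corr \<rho> \<epsilon> n C h / ?w h) \<le> ennreal (real n ^ 3 * (1 / ?w h))"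
      by (intro ennreal_leI) (simp add: divide_right_mono)
    also have "\<dots> = ennreal (real n ^ 3) * ennreal (1 / ?w h)" by (rule ennreal_mult) auto
    finally show ?thesis using False by simp
  qed
  then have "(\<integral>\<^sup>+h. ennreal (mean_corr \<rho> \<epsilon> n C h / ?w h) \<partial>lborel)
    \<le> (\<integral>\<^sup>+h. ennreal (real n * B) * ?a h + ennreal (real n ^ 3) * ?b h \<partial>lborel)"
    by (intro nn_integral_mono)
  also have "\<dots> = ennreal (real n * B) * (\<integral>\<^sup>+h. ?a h \<partial>lborel) + ennreal (real n ^ 3) * (\<integral>\<^sup>+h. ?b h \<partial>lborel)"
    by (subst nn_integral_add) (auto simp: nn_integral_cmult)
  also have "\<dots> < \<infinity>"
    using powr_origin_finite[of s "1/2"] powr_tail_finite[of s "1/2"] s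
    by (simp add: ennreal_mult_less_top)
  finally show ?thesis .
qed

lemma nonequispaced_integral_less:
  assumes C: "C \<in> equispaced_configs n" and X: "X \<in> configs n" "X \<notin> equispaced_configs n"
    and s: "0 < s" "s < 1" and \<epsilon>': "\<epsilon> \<le> 1 / 32"
    and tail: "(\<integral>\<^sup>+h. ennreal (1 / \<bar>h\<bar> powr (1 + 2 * s)) * indicator {h. 1 / 2 \<le> \<bar>h\<bar>} h \<partial>lborel) = ennreal J" "0 \<le> J"
    and small: "4 * (real n)\<^sup>2 * \<epsilon> * J < 1 / 32"
  shows "(\<integral>\<^sup>+h. ennreal (mean_corr \<rho> \<epsilon> n C h / \<bar>h\<bar> powr (1 + 2 * s)) \<partial>lborel)
       < (\<integral>\<^sup>+h. ennreal (mean_corr \<rho> \<epsilon> n X h / \<bar>h\<bar> powr (1 + 2 * s)) \<partial>lborel)"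
proof -
  have n0: "n > 0" using n by simp
  let ?w = "\<lambda>h::real. \<bar>h\<bar> powr (1 + 2 * s)"
  let ?M = "mean_corr \<rho> \<epsilon> n"
  obtain Y where Y: "periodic_sequence n Y" "\<And>h z. config_corr n X h z = cyclic_corr n Y h z"
    "(\<And>i. i < n \<Longrightarrow> Y (Suc i) - Y i = 1) \<Longrightarrow> X \<in> equispaced_configs n"
    using config_unroll[OF n0 X(1)] by metis
  interpret periodic_sequence n Y by fact
  have Cz: "config_corr n C h z = cyclic_corr n real h z" for h z
    by (rule config_corr_equispaced[OF n0 C])
  obtain i0 where i0: "i0 < n" "Y (Suc i0) - Y i0 \<noteq> 1" using Y(3) X(2) by blast
  have total: "(\<Sum>i<n. Y (Suc i) - Y i) = real n" using sum_differences[of 1] by simp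
  \<comment> \<open>The gaps have mean 1 and are not all equal to 1.\<close>
  have "\<exists>j<n. Y (Suc j) - Y j < 1"
  proof (rule ccontr)
    assume "\<not> ?thesis"
    then have ge: "\<forall>i<n. 1 \<le> Y (Suc i) - Y i" using not_less by blast
    then have "(\<Sum>i<n. 1) < (\<Sum>i<n. Y (Suc i) - Y i)"
      using i0 by (intro sum_strict_mono_ex1) (auto intro!: bexI[of _ i0] simp: less_le)
    then show False using total by simp
  qed
  then obtain j where j: "j < n" "Y (Suc j) - Y j < 1" by blast
  have n2: "n \<ge> 2"
  proof (rule ccontr)
    assume "\<not> n \<ge> 2"
    then have "n = 1" using n0 by simp
    then show False using j total by simp
  qed
  have fin: "(\<integral>\<^sup>+h. ennreal (?M C h / ?w h) \<partial>lborel) < \<infinity>"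
    using equispaced_integral_finite[OF C _ s] \<epsilon>' by simp
  show ?thesis
  proof (cases "\<forall>i. 2 * \<epsilon> \<le> Y (Suc i) - Y i")
    case True
    then have sep: "\<And>i. 2 * \<epsilon> \<le> Y (Suc i) - Y i" by blast
    have le: "?M C h \<le> ?M X h" for h
      using mean_corr_mono[of C h 0 X] separated_le(1)[OF sep] by (simp add: Cz Y(2))
    define g where "g = Y (Suc j) - Y j"
    have g: "g < 1" "0 \<le> g" using j(2) sep[of j] \<epsilon> by (auto simp: g_def)
    \<comment> \<open>The middle third of (g, 1): for |z| < (1 - g) / 3 every h in it satisfies g +
      z < h and h \<le> 1 + z, the two conditions for strictness.\<close>
    let ?I = "{(2 * g + 1) / 3<..<(g + 2) / 3}"
    have less: "?M C h < ?M X h" if h: "h \<in> ?I" for h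
    proof (rule mean_corr_strict[where \<eta> = "(1 - g) / 3"])
      show "config_corr n C h z \<le> config_corr n X h z" if "\<bar>z\<bar> < 2 * \<epsilon>" for z
        using separated_le(1)[OF sep] that by (simp add: Cz Y(2))
      show "config_corr n C h z < config_corr n X h z" if "\<bar>z\<bar> < (1 - g) / 3" "\<bar>z\<bar> < 2 * \<epsilon>" for z
        unfolding Cz Y(2)
        by (rule separated_le(2)[OF sep _ _ _ _ n2 j(1)])
           (use that h g in \<open>auto simp: g_def[symmetric] abs_less_iff field_simps\<close>)
    qed (use g in simp)
    show ?thesis
    proof (rule nn_integral_less)
      show "AE h in lborel. ennreal (?M C h / ?w h) \<le> ennreal (?M X h / ?w h)"
        using le by (intro AE_I2 ennreal_leI divide_right_mono) auto
      show "\<not> (AE h in lborel. ennreal (?M X h / ?w h) \<le> ennreal (?M C h / ?w h))"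
      proof
        assume "AE h in lborel. ennreal (?M X h / ?w h) \<le> ennreal (?M C h / ?w h)"
        then have "AE h in lborel. h \<notin> ?I"
        proof eventually_elim
          case (elim h)
          show ?case
          proof
            assume h: "h \<in> ?I"
            then have "h > 0" using g by simp
            then have "?M C h / ?w h < ?M X h / ?w h" using less[OF h] by (intro divide_strict_right_mono) auto
            moreover have "0 \<le> ?M C h / ?w h" by (simp add: mean_corr_nonneg)
            ultimately have "ennreal (?M C h / ?w h) < ennreal (?M X h / ?w h)" by (simp add: ennreal_less_iff)
            then show False using elim by simp
          qed
        qed
        then have "?I \<in> null_sets lborel" by (subst AE_iff_null_sets) auto
        then have "emeasure lborel ?I = 0" by (rule null_setsD1)
        then show False using g by (simp add: field_simps)
      qed
    qed (use fin in auto)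
  next
    case False
    then obtain i where i: "Y (Suc i) - Y i < 2 * \<epsilon>" by (auto simp: not_le)
    \<comment> \<open>The short gap may occur at any index; by periodicity it recurs at an index
      below n, as \<open>small_step_le\<close> demands.\<close>
    define l where "l = i mod n"
    have l: "l < n" "Y (Suc l) - Y l < 2 * \<epsilon>"
    proof -
      have per: "Y (m + k * n) = Y m + real k * real n" for m k
      proof (induction k)
        case (Suc k)
        then show ?case using period[of "m + k * n"] by (simp add: algebra_simps)
      qed simp
      have "Y i = Y l + real (i div n) * real n"
        using per[of l "i div n"] by (simp add: l_def mult.commute)
      moreover have "Y (Suc i) = Y (Suc l) + real (i div n) * real n"
        using per[of "Suc l" "i div n"] by (simp add: l_def mult.commute)
      ultimately show "Y (Suc l) - Y l < 2 * \<epsilon>" using i by simp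
      show "l < n" using n0 by (simp add: l_def)
    qed
    have lower: "?M C h - 4 * (real n)\<^sup>2 * \<epsilon> \<le> ?M X h" for h
      using mean_corr_mono[of C h "- (4 * (real n)\<^sup>2 * \<epsilon>)" X] cyclic_corr_lower[of _ "2 * \<epsilon>" h] \<epsilon>'
      by (simp add: Cz Y(2) mult_ac)
    have near: "?M C h \<le> ?M X h" if "\<bar>h\<bar> \<le> 1/2" for h
      using mean_corr_mono[of C h 0 X] small_step_le(1)[OF _ that] \<epsilon>' by (simp add: Cz Y(2))
    \<comment> \<open>The gap and |z| are both below 2 \<epsilon> \<le> 1/16, so h \<ge> 1/4 leaves
      at least 1/4 - 1/16 - 1/16 = 1/8.\<close>
    have gain: "?M C h + 1/8 \<le> ?M X h" if h: "1/4 \<le> h" "h < 1/2" for h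
    proof (rule mean_corr_mono)
      fix z assume z: "\<bar>z\<bar> < 2 * \<epsilon>"
      have "cyclic_corr n real h z + (h - (Y (Suc l) - Y l) - \<bar>z\<bar>) \<le> cyclic_corr n Y h z"
        by (rule small_step_le(2)) (use z h \<epsilon>' l(1) n2 in auto)
      then show "config_corr n C h z + 1/8 \<le> config_corr n X h z"
        using z h \<epsilon>' l(2) unfolding Cz Y(2) by linarith
    qed
    let ?t = "\<lambda>h. ennreal (1 / ?w h) * indicator {h. 1/2 \<le> \<bar>h\<bar>} h"
    let ?D = "4 * (real n)\<^sup>2 * \<epsilon>"
    have D0: "?D \<ge> 0" using \<epsilon> by simp
    \<comment> \<open>The loss is added on the right instead of subtracted on the left, so that the
      estimate can be integrated in [0, \<infinity>]; \<open>?t\<close> is the part of the weight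
      with finite integral.\<close>
    have pw: "ennreal (?M C h / ?w h) + ennreal (1/8) * indicator {1/4..<1/2} h
        \<le> ennreal (?M X h / ?w h) + ennreal ?D * ?t h" for h
    proof -
      consider "1/4 \<le> h" "h < 1/2" | "\<bar>h\<bar> < 1/2" "h \<notin> {1/4..<1/2}" | "1/2 \<le> \<bar>h\<bar>" by force
      then show ?thesis
      proof cases
        case 1
        \<comment> \<open>The denominator is at most 1 for h < 1/2, so dividing by it only enlarges
          the gain.\<close>
        have "?w h \<le> 1 powr (1 + 2 * s)" using 1 s by (intro powr_mono2) auto
        then have w: "0 < ?w h" "?w h \<le> 1" using 1 by auto
        have "?M C h / ?w h + 1/8 \<le> ?M C h / ?w h + (1/8) / ?w h" using w by (simp add: field_simps)
        also have "\<dots> \<le> ?M X h / ?w h"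
          unfolding add_divide_distrib[symmetric] using gain[OF 1] w by (intro divide_right_mono) auto
        finally have "ennreal (?M C h / ?w h + 1/8) \<le> ennreal (?M X h / ?w h)" by (rule ennreal_leI)
        then show ?thesis using 1 by (simp add: ennreal_plus mean_corr_nonneg add_increasing2)
      next
        case 2
        then have "ennreal (?M C h / ?w h) \<le> ennreal (?M X h / ?w h)"
          using near[of h] by (intro ennreal_leI divide_right_mono) auto
        then show ?thesis using 2 by simp
      next
        case 3
        have "?M C h / ?w h \<le> ?M X h / ?w h + ?D * (1 / ?w h)"
          using divide_right_mono[OF lower[of h], of "?w h"] by (simp add: diff_divide_distrib)
        then have "ennreal (?M C h / ?w h) \<le> ennreal (?M X h / ?w h + ?D * (1 / ?w h))" by (rule ennreal_leI)
        also have "\<dots> = ennreal (?M X h / ?w h) + ennreal ?D * ennreal (1 / ?w h)"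
          using D0 by (subst ennreal_plus) (auto simp: mean_corr_nonneg ennreal_mult[symmetric])
        finally show ?thesis using 3 by (auto simp: indicator_def)
      qed
    qed
    let ?IC = "\<integral>\<^sup>+h. ennreal (?M C h / ?w h) \<partial>lborel" and ?IX = "\<integral>\<^sup>+h. ennreal (?M X h / ?w h) \<partial>lborel"
    \<comment> \<open>The gain 1/8 times the length 1/4 of the interval.\<close>
    have "?IC + ennreal (1/32) = (\<integral>\<^sup>+h. ennreal (?M C h / ?w h) + ennreal (1/8) * indicator {1/4..<1/2} h \<partial>lborel)"
      by (subst nn_integral_add) (auto simp: nn_integral_cmult_indicator ennreal_mult[symmetric])
    also have "\<dots> \<le> (\<integral>\<^sup>+h. ennreal (?M X h / ?w h) + ennreal ?D * ?t h \<partial>lborel)"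
      by (intro nn_integral_mono pw)
    also have "\<dots> = ?IX + (\<integral>\<^sup>+h. ennreal ?D * ?t h \<partial>lborel)"
      by (rule nn_integral_add) measurable
    also have "(\<integral>\<^sup>+h. ennreal ?D * ?t h \<partial>lborel) = ennreal ?D * ennreal J"
      unfolding tail(1)[symmetric] by (rule nn_integral_cmult) measurable
    also have "ennreal ?D * ennreal J = ennreal (?D * J)" using D0 tail(2) by (simp add: ennreal_mult)
    finally have le: "?IC + ennreal (1/32) \<le> ?IX + ennreal (?D * J)" .
    show ?thesis
    proof (rule ccontr)
      assume "\<not> ?IC < ?IX"
      then have "?IX \<le> ?IC" by simp
      then have "?IC + ennreal (1/32) \<le> ?IC + ennreal (?D * J)" using le add_right_mono order_trans by blast
      \<comment> \<open>Cancelling \<open>?IC\<close> is legitimate because it is finite.\<close>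
      then have "ennreal (1/32) \<le> ennreal (?D * J)" using fin by (auto simp: ennreal_add_left_cancel_le)
      then have "1/32 \<le> ?D * J" using D0 tail(2) by (simp add: ennreal_le_iff del: ennreal_le_iff2)
      then show False using small by simp
    qed
  qed
qed

end

lemma equispaced_exists: "(\<lambda>i\<in>{1..n}. real i - 1) \<in> equispaced_configs n"
proof -
  let ?X = "\<lambda>i\<in>{1..n}. real i - 1"
  have "?X ` {1..n} = {real j + 0 | j. j < n}"
  proof (intro equalityI subsetI)
    fix x assume "x \<in> ?X ` {1..n}"
    then obtain i where "i \<in> {1..n}" "x = real i - 1" by auto
    then show "x \<in> {real j + 0 | j. j < n}" by (auto intro!: exI[of _ "i - 1"] simp: of_nat_diff)
  next
    fix x assume "x \<in> {real j + 0 | j. j < n}"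
    then obtain j where "j < n" "x = real j" by auto
    then show "x \<in> ?X ` {1..n}" by (intro image_eqI[of _ _ "Suc j"]) auto
  qed
  moreover have "?X \<in> distinct_configs n"
    by (auto simp: distinct_configs_def configs_def inj_on_def)
  ultimately show ?thesis
    unfolding equispaced_configs_def by (intro CollectI conjI exI[of _ "0::real"]) (assumption | simp only: order_refl zero_less_one)+
qed

theorem theorem3p2:
  fixes \<rho> :: "real \<Rightarrow> real" and s :: real and \<Lambda> :: nat
  assumes "mollifier \<rho>"
    and "1 / 2 \<le> s" and "s < 1"
    and "\<Lambda> \<ge> 1"
  shows "\<exists>\<epsilon>0>0. \<forall>\<epsilon>. 0 < \<epsilon> \<and> \<epsilon> < \<epsilon>0 \<longrightarrow>
           global_minimizers (configs \<Lambda>) (energy \<rho> s \<epsilon> \<Lambda>) = equispaced_configs \<Lambda>"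
proof -
  have s: "0 < s" "s < 1" using assms by auto
  have \<Lambda>: "\<Lambda> > 0" using assms by simp
  define T where "T = (\<integral>\<^sup>+h. ennreal (1 / \<bar>h\<bar> powr (1 + 2 * s)) * indicator {h. 1 / 2 \<le> \<bar>h\<bar>} h \<partial>lborel)"
  have "T < \<infinity>" unfolding T_def by (rule powr_tail_finite) (use s in auto)
  then obtain J where J: "T = ennreal J" "0 \<le> J" by (cases T) auto
  \<comment> \<open>The first bound gives 2 \<epsilon> \<le> 1/16, as the gain estimate needs. The
    second makes the total loss \<open>4 * (real \<Lambda>)\<^sup>2 * \<epsilon> * J\<close> smaller
    than the total gain 1/32, with 128 = 4 * 32; J + 1 in place of J keeps the denominator
    positive.\<close>
  define \<epsilon>0 where "\<epsilon>0 = min (1 / 32) (1 / (128 * (real \<Lambda>)\<^sup>2 * (J + 1)))"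
  have p: "0 < 128 * (real \<Lambda>)\<^sup>2 * (J + 1)" using \<Lambda> J(2) by simp
  show ?thesis
  proof (intro exI[of _ \<epsilon>0] conjI allI impI)
    show "0 < \<epsilon>0" unfolding \<epsilon>0_def using p by simp
    fix \<epsilon> assume "0 < \<epsilon> \<and> \<epsilon> < \<epsilon>0"
    then have \<epsilon>: "0 < \<epsilon>" "\<epsilon> \<le> 1 / 32" "\<epsilon> < 1 / (128 * (real \<Lambda>)\<^sup>2 * (J + 1))" by (auto simp: \<epsilon>0_def)
    have "128 * (real \<Lambda>)\<^sup>2 * \<epsilon> * J \<le> \<epsilon> * (128 * (real \<Lambda>)\<^sup>2 * (J + 1))" using \<epsilon>(1) by (simp add: algebra_simps)
    also have "\<dots> < 1" using \<epsilon>(3) p by (simp add: field_simps)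
    finally have small: "4 * (real \<Lambda>)\<^sup>2 * \<epsilon> * J < 1 / 32" by simp
    note en = energy_eq[OF assms(1) \<epsilon>(1) assms(4), of s]
    have half: "1 / 2 * a < 1 / 2 * b" if "a < b" for a b :: ennreal
    proof (rule ennreal_mult_strict_left_mono[OF that])
      have half: "(1 / 2 :: ennreal) = ennreal (1 / 2)" using divide_ennreal[of 1 2] by simp
      show "0 < (1 / 2 :: ennreal)" unfolding half by (rule ennreal_less_zero_iff[THEN iffD2]) simp
      show "(1 / 2 :: ennreal) < top" unfolding half by (rule ennreal_less_top)
    qed
    have less: "energy \<rho> s \<epsilon> \<Lambda> C < energy \<rho> s \<epsilon> \<Lambda> X"
      if "C \<in> equispaced_configs \<Lambda>" "X \<in> configs \<Lambda>" "X \<notin> equispaced_configs \<Lambda>" for C X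
      unfolding en
      by (intro half nonequispaced_integral_less[OF assms(1) \<epsilon>(1) assms(4) that s \<epsilon>(2) J(1)[unfolded T_def] J(2) small])
    have eq: "energy \<rho> s \<epsilon> \<Lambda> C = energy \<rho> s \<epsilon> \<Lambda> C'"
      if "C \<in> equispaced_configs \<Lambda>" "C' \<in> equispaced_configs \<Lambda>" for C C'
      unfolding en mean_corr_def config_corr_equispaced[OF \<Lambda> that(1)] config_corr_equispaced[OF \<Lambda> that(2)] ..
    have sub: "equispaced_configs \<Lambda> \<subseteq> configs \<Lambda>"
      by (auto simp: equispaced_configs_def distinct_configs_def)
    show "global_minimizers (configs \<Lambda>) (energy \<rho> s \<epsilon> \<Lambda>) = equispaced_configs \<Lambda>"
    proof (intro equalityI subsetI)
      fix X assume X: "X \<in> global_minimizers (configs \<Lambda>) (energy \<rho> s \<epsilon> \<Lambda>)"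
      show "X \<in> equispaced_configs \<Lambda>"
      proof (rule ccontr)
        assume "X \<notin> equispaced_configs \<Lambda>"
        then show False
          using X less[OF equispaced_exists[of \<Lambda>], of X] sub equispaced_exists[of \<Lambda>]
          unfolding global_minimizers_def by (blast dest: leD)
      qed
    next
      fix C assume C: "C \<in> equispaced_configs \<Lambda>"
      have "energy \<rho> s \<epsilon> \<Lambda> C \<le> energy \<rho> s \<epsilon> \<Lambda> X" if "X \<in> configs \<Lambda>" for X
        using less[OF C that] eq[OF C, of X] by (cases "X \<in> equispaced_configs \<Lambda>") (auto intro: less_imp_le)
      then show "C \<in> global_minimizers (configs \<Lambda>) (energy \<rho> s \<epsilon> \<Lambda>)"
        using C sub unfolding global_minimizers_def by blast
    qed
  qed
qed

end
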